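(* Let $w,m$ be nonzero real numbers and $u\in\mathbb{R}$, let $\mathcal{U}_q=\mathcal{U}_q(G(1))$ be the one-dimensional quantum Galilei algebra with deformation parameter $iw$, and let $H_{m,u}=\varphi_{m,u}H_0$, with linear basis $\{\varphi_{m,u}\chi_m^\ell\}_{\ell\in\mathbb{Z}}$, be the induced representation space described in the context. For $X\in\mathcal{U}_q$ and $a\in H_{m,u}$ let $$\widetilde\rho_{m,u}(X)a=\sum_{(X)}X_{(1)}.a\;\phi[X_{(2)}],\qquad \phi[X]=\epsilon(X)+\sum_{n=1}^\infty\Big(\frac{wm}{2}\Big)^n\frac{(2n-1)!!}{n!}\,X(v^n)\,\chi_m^n.$$ Then the representation $\widetilde\rho_{m,u}$ of $\mathcal{U}_q(G(1))$ is given by $$\widetilde\rho_{m,u}(K^{\pm1})\,\varphi_{m,u}\chi_m^\ell=\varphi_{m,u}\chi_m^{\ell\pm1},\qquad \widetilde\rho_{m,u}(B)\,\varphi_{m,u}\chi_m^\ell=iwm\,\big(\ell+\tfrac12\big)\,\varphi_{m,u}\chi_m^\ell,$$ $$\widetilde\rho_{m,u}(T)\,\varphi_{m,u}\chi_m^\ell=\varphi_{m,u}\chi_m^\ell\Big(-\frac{1}{2w^2m}\,(2-\chi_m-\chi_m^{-1})+u\Big),$$ and it is unitary with respect to the sesquilinear form $$\langle\varphi_{m,u}\chi_m^\ell,\varphi_{m,u}\chi_m^n\rangle=\delta_{\ell+n+1,0},$$ i.e. $\langle a,\widetilde\rho_{m,u}(X)b\rangle=\langle\widetilde\rho_{m,u}(X^*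 )a,b\rangle$ for all $X\in\mathcal{U}_q(G(1))$ and $a,b\in H_{m,u}$.
   Context: Quantum Galilei algebra: $\mathcal{U}_q(G(1))$ is the Hopf $*$-algebra over $\mathbb{C}$ generated by $K,K^{-1},B,M,T$ with $M$ central, $KK^{-1}=K^{-1}K=1$, and $$[K,T]=0,\qquad KBK^{-1}=B-iwM,\qquad [B,T]=i\,\frac{K-K^{-1}}{2w},$$ coproduct $\Delta M=M\otimes K+K^{-1}\otimes M$, $\Delta K=K\otimes K$, $\Delta T=T\otimes1+1\otimes T$, $\Delta B=B\otimes K+K^{-1}\otimes B$; antipode $S(M)=-M$, $S(K)=K^{-1}$, $S(T)=-T$, $S(B)=-B+iwM$; counit $\epsilon(M)=\epsilon(T)=\epsilon(B)=0$, $\epsilon(K)=1$; and involution making $K,B,M,T$ self-adjoint. With $I=K^{-1}M$ and $N=KB$, the elements $I^{\alpha}K^{\ell}T^{\gamma}N^{\delta}$ ($\alpha,\gamma,\delta\in\mathbb{N}$, $\ell\in\mathbb{Z}$) form a linear basis. The dual function algebra $\mathcal{F}_q(G(1))$ is generated by $\mu,x,t,v$, and is paired with $\mathcal{U}_q$ by $$(I^{\alpha'}K^{\ell}T^{\gamma'}N^{\delta'})(\mu^\alpha x^\beta t^\gamma v^\delta)=i^{\alpha+\beta+\gamma+\delta}\,\alpha!\,\gamma!\,\delta!\,(-iw\ell)^\beta\,\delta_{\alpha,\alpha'}\delta_{\gamma,\gamma'}\delta_{\delta,\delta'}.$$ The linear dual $\mathcal{U}_q^{\,*}$ is an algebra under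 the convolution product $(fg)(X)=\sum_{(X)}f(X_{(1)})g(X_{(2)})$ with unit $\epsilon$, and $\mathcal{U}_q$ acts on it on the left by the left regular representation $(X.f)(Y)=f(YX)$, i.e. $X.f=(\mathrm{id}\otimes X)\Delta f$; the action binds tighter than multiplication. In $\mathcal{U}_q^{\,*}$ consider $v$, so that $X(v^n)$ is determined by $(I^{\alpha}K^{\ell}T^{\gamma}N^{\delta})(v^n)=i^nn!\,\delta_{\alpha,0}\delta_{\gamma,0}\delta_{\delta,n}$, and $\varphi_{m,u}=e^{-i(m\mu+ut)}$, i.e. the functional with $\varphi_{m,u}(I^{\alpha}K^{\ell}T^{\gamma}N^{\delta})=m^\alpha u^\gamma\delta_{\delta,0}$, which is invertible. Put $v_0=v$ and $v_1=\varphi_{m,u}^{-1}\,v\,\varphi_{m,u}$. They commute and satisfy $wm\,v_0v_1=v_1-v_0$; they generate the algebra $H_0$ (denoted $H_0^{\mathrm{irr}}$ in the source), a $*$-algebra with $v_0^*=v_0$, $v_1^*=v_1$. With $\chi_m=1+wm\,v_1$ one has $\chi_m^{-1}=1-wm\,v_0$, and $\{\chi_m^\ell\}_{\ell\in\mathbb{Z}}$ is a linear basis of $H_0$. On $H_0$ the action of $\mathcal{U}_q$ is $B.\chi_m^\ell=iwm\,\ell\,\chi_m^{\ell+1}$, $K.f=f$, $T.f=M.f=0$. The induced representation space is $H_{m,u}=\varphi_{m,u}H_0\subset\mathcal{U}_q^{\,*}$ (denoted $H_{m,u}^{\mathrm{irr}}$ in the source), stable under the left regular action and under right multiplication by $H_0$.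 The sesquilinear form (antilinear in the first argument) in the claim is $\langle a,b\rangle=\nu_w(a^*b)$, where $\nu_w:H_0\to\mathbb{C}$ is linear with $\nu_w(\chi_m^\ell)=\delta_{\ell,0}$ and $\varphi_{m,u}^*\varphi_{m,u}=\chi_m$. *)

theory Defs
  imports
    Complex_Main
    "HOL-Library.Poly_Mapping"
    "HOL-Library.Product_Plus"
    "HOL-Library.Function_Algebras"
    "HOL-Algebra.Ideal"
begin

section \<open>The free algebra on the generators\<close>

text \<open>
  The free algebra on \<open>K, K\<^sup>-, B, M, T\<close> is the monoid algebra of the free monoid of words.
  The monoid of words is written additively so that multiplication of finitely supported maps
  is the convolution provided by the library. With the componentwise monoid structure on pairs
  of words, the same construction yields the tensor square of the free algebra as an algebra.
\<close>

datatype gen = GenK | GenKinv | GenB | GenM | GenT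

datatype word = Word (letters: "gen list")

instantiation word :: monoid_add
begin

definition zero_word :: word where "zero_word = Word []"

definition plus_word :: "word \<Rightarrow> word \<Rightarrow> word" where
  "plus_word x y = Word (letters x @ letters y)"

instance
  by standard (simp_all add: zero_word_def plus_word_def)

end

type_synonym falg = "word \<Rightarrow>\<^sub>0 complex"
type_synonym falg2 = "(word \<times> word) \<Rightarrow>\<^sub>0 complex"

definition smul :: "complex \<Rightarrow> ('a::monoid_add \<Rightarrow>\<^sub>0 complex) \<Rightarrow> ('a \<Rightarrow>\<^sub>0 complex)" where
  "smul c X = Poly_Mapping.single 0 c * X"

definition letter :: "gen \<Rightarrow> falg" where
  "letter g = Poly_Mapping.single (Word [g]) 1"

definition Kq :: falg where "Kq = letter GenK"
definition Kinvq :: falg where "Kinvq = letter GenKinv"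
definition Bq :: falg where "Bq = letter GenB"
definition Mq :: falg where "Mq = letter GenM"
definition Tq :: falg where "Tq = letter GenT"

text \<open>
  Extension of a map on generators to an algebra homomorphism, respectively to an algebra
  antihomomorphism, on the free algebra.
\<close>

definition hom_ext ::
  "(gen \<Rightarrow> ('a::monoid_add \<Rightarrow>\<^sub>0 complex)) \<Rightarrow> falg \<Rightarrow> ('a \<Rightarrow>\<^sub>0 complex)" where
  "hom_ext h X =
     (\<Sum>x\<in>Poly_Mapping.keys X. smul (Poly_Mapping.lookup X x) (prod_list (map h (letters x))))"

definition antihom_ext ::
  "(gen \<Rightarrow> ('a::monoid_add \<Rightarrow>\<^sub>0 complex)) \<Rightarrow> falg \<Rightarrow> ('a \<Rightarrow>\<^sub>0 complex)" where
  "antihom_ext h X =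
     (\<Sum>x\<in>Poly_Mapping.keys X. smul (Poly_Mapping.lookup X x) (prod_list (map h (rev (letters x)))))"

section \<open>The quantum Galilei algebra\<close>

text \<open>
  The algebra \<open>U\<^sub>q(G(1))\<close> with deformation parameter \<open>iw\<close> is the quotient of the free algebra by
  the two-sided ideal \<open>galilei_ideal w\<close>. Its elements are given by representatives in the free
  algebra, equality being congruence modulo this ideal; coproduct, counit, antipode and involution
  are given by the structure maps of the free algebra that induce them on the quotient.
\<close>

definition free_ring :: "falg ring" where
  "free_ring = \<lparr>carrier = UNIV, monoid.mult = (*), one = 1, zero = 0, add = (+)\<rparr>"

definition relators :: "real \<Rightarrow> falg set" where
  "relators w =
     {Kq * Kinvq - 1, Kinvq * Kq - 1} \<union>
     {Mq * X - X * Mq | X. X \<in> {Kq, Kinvq, Bq, Tq}} \<union>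
     {Kq * Tq - Tq * Kq,
      Kq * Bq * Kinvq - (Bq - smul (\<i> * of_real w) Mq),
      (Bq * Tq - Tq * Bq) - smul (\<i> / (2 * of_real w)) (Kq - Kinvq)}"

definition galilei_ideal :: "real \<Rightarrow> falg set" where
  "galilei_ideal w = Idl\<^bsub>free_ring\<^esub> (relators w)"

definition tens :: "falg \<Rightarrow> falg \<Rightarrow> falg2" where
  "tens X Y = (\<Sum>x\<in>Poly_Mapping.keys X. \<Sum>y\<in>Poly_Mapping.keys Y.
       Poly_Mapping.single (x, y) (Poly_Mapping.lookup X x * Poly_Mapping.lookup Y y))"

fun coprod_gen :: "gen \<Rightarrow> falg2" where
  "coprod_gen GenK = tens Kq Kq"
| "coprod_gen GenKinv = tens Kinvq Kinvq"
| "coprod_gen GenM = tens Mq Kq + tens Kinvq Mq"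
| "coprod_gen GenT = tens Tq 1 + tens 1 Tq"
| "coprod_gen GenB = tens Bq Kq + tens Kinvq Bq"

definition coprod :: "falg \<Rightarrow> falg2" where
  "coprod = hom_ext coprod_gen"

fun counit_gen :: "gen \<Rightarrow> complex" where
  "counit_gen GenK = 1"
| "counit_gen GenKinv = 1"
| "counit_gen GenM = 0"
| "counit_gen GenT = 0"
| "counit_gen GenB = 0"

definition counit :: "falg \<Rightarrow> complex" where
  "counit X = (\<Sum>x\<in>Poly_Mapping.keys X. Poly_Mapping.lookup X x * prod_list (map counit_gen (letters x)))"

fun antipode_gen :: "real \<Rightarrow> gen \<Rightarrow> falg" where
  "antipode_gen w GenK = Kinvq"
| "antipode_gen w GenKinv = Kq"
| "antipode_gen w GenM = - Mq"
| "antipode_gen w GenT = - Tq"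
| "antipode_gen w GenB = - Bq + smul (\<i> * of_real w) Mq"

definition antipode :: "real \<Rightarrow> falg \<Rightarrow> falg" where
  "antipode w = antihom_ext (antipode_gen w)"

text \<open>The antilinear antihomomorphism fixing all generators.\<close>

definition star :: "falg \<Rightarrow> falg" where
  "star X = (\<Sum>x\<in>Poly_Mapping.keys X. Poly_Mapping.single (Word (rev (letters x))) (cnj (Poly_Mapping.lookup X x)))"

definition Kpow :: "int \<Rightarrow> falg" where
  "Kpow l = (if 0 \<le> l then Kq ^ nat l else Kinvq ^ nat (- l))"

text \<open>The basis monomials \<open>I\<^sup>a K\<^sup>l T\<^sup>c N\<^sup>d\<close>, where \<open>I = K\<^sup>-M\<close> and \<open>N = KB\<close>.\<close>

definition pbw :: "nat \<Rightarrow> int \<Rightarrow> nat \<Rightarrow> nat \<Rightarrow> falg" where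
  "pbw a l c d = (Kinvq * Mq) ^ a * Kpow l * Tq ^ c * (Kq * Bq) ^ d"

section \<open>The dual algebra\<close>

definition fscale :: "complex \<Rightarrow> (falg \<Rightarrow> complex) \<Rightarrow> falg \<Rightarrow> complex" where
  "fscale c f = (\<lambda>X. c * f X)"

interpretation fun_vs: vector_space fscale
  by standard (auto simp: fscale_def fun_eq_iff algebra_simps)

text \<open>Linear functionals on the quotient, i.e. functionals on the free algebra that kill the ideal.\<close>

definition Udual :: "real \<Rightarrow> (falg \<Rightarrow> complex) set" where
  "Udual w =
     {f. Vector_Spaces.linear smul (*) f \<and> (\<forall>X \<in> galilei_ideal w. f X = 0)}"

text \<open>
  \<open>sweedler X \<beta>\<close> is \<open>\<Sum> \<beta>(X\<^sub>1, X\<^sub>2)\<close>, the value of the bilinear map \<open>\<beta>\<close> on the coproduct of \<open>X\<close>.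
\<close>

definition sweedler :: "falg \<Rightarrow> (falg \<Rightarrow> falg \<Rightarrow> complex) \<Rightarrow> complex" where
  "sweedler X \<beta> =
     (\<Sum>(x, y)\<in>Poly_Mapping.keys (coprod X).
        Poly_Mapping.lookup (coprod X) (x, y) * \<beta> (Poly_Mapping.single x 1) (Poly_Mapping.single y 1))"

definition conv :: "(falg \<Rightarrow> complex) \<Rightarrow> (falg \<Rightarrow> complex) \<Rightarrow> falg \<Rightarrow> complex"
    (infixl \<open>\<star>\<close> 70) where
  "f \<star> g = (\<lambda>X. sweedler X (\<lambda>X1 X2. f X1 * g X2))"

definition dual_alg :: "real \<Rightarrow> (falg \<Rightarrow> complex) ring" where
  "dual_alg w =
     \<lparr>carrier = Udual w, monoid.mult = conv, one = counit, zero = 0, add = (+)\<rparr>"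

text \<open>The left regular action \<open>(X.f)(Y) = f(YX)\<close>.\<close>

definition act :: "falg \<Rightarrow> (falg \<Rightarrow> complex) \<Rightarrow> falg \<Rightarrow> complex" where
  "act X f = (\<lambda>Y. f (Y * X))"

text \<open>The involution of the dual algebra, \<open>f\<^sup>*(X)\<close> being the complex conjugate of \<open>f(S(X)\<^sup>*)\<close>.\<close>

definition dual_star :: "real \<Rightarrow> (falg \<Rightarrow> complex) \<Rightarrow> falg \<Rightarrow> complex" where
  "dual_star w f = (\<lambda>X. cnj (f (star (antipode w X))))"

text \<open>The smallest unital subalgebra of the dual algebra containing \<open>S\<close>.\<close>

inductive_set subalg :: "(falg \<Rightarrow> complex) set \<Rightarrow> (falg \<Rightarrow> complex) set"
  for S :: "(falg \<Rightarrow> complex) set" where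
  unit: "counit \<in> subalg S"
| incl: "f \<in> S \<Longrightarrow> f \<in> subalg S"
| plus: "f \<in> subalg S \<Longrightarrow> g \<in> subalg S \<Longrightarrow> f + g \<in> subalg S"
| scale: "f \<in> subalg S \<Longrightarrow> fscale c f \<in> subalg S"
| mult: "f \<in> subalg S \<Longrightarrow> g \<in> subalg S \<Longrightarrow> f \<star> g \<in> subalg S"

section \<open>The induced representation space\<close>

definition vq :: "real \<Rightarrow> falg \<Rightarrow> complex" where
  "vq w = (THE f. f \<in> Udual w \<and>
     (\<forall>a l c d. f (pbw a l c d) = (if a = 0 \<and> c = 0 \<and> d = 1 then \<i> else 0)))"

definition phi :: "real \<Rightarrow> real \<Rightarrow> real \<Rightarrow> falg \<Rightarrow> complex" where
  "phi w m u = (THE f. f \<in> Udual w \<and>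
     (\<forall>a l c d. f (pbw a l c d) = (if d = 0 then of_real (m ^ a * u ^ c) else 0)))"

definition v1 :: "real \<Rightarrow> real \<Rightarrow> real \<Rightarrow> falg \<Rightarrow> complex" where
  "v1 w m u = inv\<^bsub>dual_alg w\<^esub> (phi w m u) \<star> vq w \<star> phi w m u"

definition H0 :: "real \<Rightarrow> real \<Rightarrow> real \<Rightarrow> (falg \<Rightarrow> complex) set" where
  "H0 w m u = subalg {vq w, v1 w m u}"

definition chi :: "real \<Rightarrow> real \<Rightarrow> real \<Rightarrow> falg \<Rightarrow> complex" where
  "chi w m u = counit + fscale (of_real (w * m)) (v1 w m u)"

definition chipow :: "real \<Rightarrow> real \<Rightarrow> real \<Rightarrow> int \<Rightarrow> falg \<Rightarrow> complex" where
  "chipow w m u l = chi w m u [^]\<^bsub>dual_alg w\<^esub> l"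

definition Hspace :: "real \<Rightarrow> real \<Rightarrow> real \<Rightarrow> (falg \<Rightarrow> complex) set" where
  "Hspace w m u = (\<lambda>h. phi w m u \<star> h) ` H0 w m u"

definition ebasis :: "real \<Rightarrow> real \<Rightarrow> real \<Rightarrow> int \<Rightarrow> falg \<Rightarrow> complex" where
  "ebasis w m u l = phi w m u \<star> chipow w m u l"

section \<open>The modified action and the sesquilinear form\<close>

text \<open>\<open>odd_fact n\<close> is \<open>(2n - 1)!!\<close>\<close>

definition odd_fact :: "nat \<Rightarrow> nat" where
  "odd_fact n = (\<Prod>k = 1..n. 2 * k - 1)"

text \<open>
  For each \<open>X\<close> only finitely many \<open>n\<close> satisfy \<open>X(v\<^sup>n) \<noteq> 0\<close>, so the series is the finite sum over
  these \<open>n\<close>.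
\<close>

definition phi_bracket :: "real \<Rightarrow> real \<Rightarrow> real \<Rightarrow> falg \<Rightarrow> falg \<Rightarrow> complex" where
  "phi_bracket w m u X =
     fscale (counit X) counit +
     (\<Sum>n | 1 \<le> n \<and> (vq w [^]\<^bsub>dual_alg w\<^esub> n) X \<noteq> 0.
        fscale (of_real ((w * m / 2) ^ n * real (odd_fact n) / fact n) *
                (vq w [^]\<^bsub>dual_alg w\<^esub> n) X)
          (chipow w m u (int n)))"

definition rho :: "real \<Rightarrow> real \<Rightarrow> real \<Rightarrow> falg \<Rightarrow> (falg \<Rightarrow> complex) \<Rightarrow> falg \<Rightarrow> complex" where
  "rho w m u X a =
     (\<lambda>Y. sweedler X (\<lambda>X1 X2. (act X1 a \<star> phi_bracket w m u X2) Y))"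

text \<open>The coefficient of \<open>\<chi>\<^sup>0\<close> with respect to the basis of all integer powers of \<open>\<chi>\<close>.\<close>

definition nu :: "real \<Rightarrow> real \<Rightarrow> real \<Rightarrow> (falg \<Rightarrow> complex) \<Rightarrow> complex" where
  "nu w m u h = fun_vs.representation (range (chipow w m u)) h (chipow w m u 0)"

definition form ::
  "real \<Rightarrow> real \<Rightarrow> real \<Rightarrow> (falg \<Rightarrow> complex) \<Rightarrow> (falg \<Rightarrow> complex) \<Rightarrow> complex" where
  "form w m u a b = nu w m u (dual_star w a \<star> b)"

definition is_representation ::
  "real \<Rightarrow> (falg \<Rightarrow> complex) set \<Rightarrow> (falg \<Rightarrow> (falg \<Rightarrow> complex) \<Rightarrow> (falg \<Rightarrow> complex)) \<Rightarrow> bool" where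
  "is_representation w V r \<longleftrightarrow>
     fun_vs.subspace V \<and>
     (\<forall>X. \<forall>a\<in>V. r X a \<in> V) \<and>
     (\<forall>X. \<forall>a\<in>V. \<forall>b\<in>V. r X (a + b) = r X a + r X b) \<and>
     (\<forall>X c. \<forall>a\<in>V. r X (fscale c a) = fscale c (r X a)) \<and>
     (\<forall>X Y. \<forall>a\<in>V. r (X + Y) a = r X a + r Y a) \<and>
     (\<forall>X c. \<forall>a\<in>V. r (smul c X) a = fscale c (r X a)) \<and>
     (\<forall>a\<in>V. r 1 a = a) \<and>
     (\<forall>X Y. \<forall>a\<in>V. r (X * Y) a = r X (r Y a)) \<and>
     (\<forall>X\<in>galilei_ideal w. \<forall>a\<in>V. r X a = 0)"

definition sesquilinear_on ::
  "(falg \<Rightarrow> complex) set \<Rightarrow> ((falg \<Rightarrow> complex) \<Rightarrow> (falg \<Rightarrow> complex) \<Rightarrow> complex) \<Rightarrow> bool" where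
  "sesquilinear_on V s \<longleftrightarrow>
     (\<forall>a\<in>V. \<forall>b\<in>V. \<forall>c\<in>V. s (a + b) c = s a c + s b c \<and> s c (a + b) = s c a + s c b) \<and>
     (\<forall>k. \<forall>a\<in>V. \<forall>b\<in>V. s (fscale k a) b = cnj k * s a b \<and> s a (fscale k b) = k * s a b)"

end

(*
  A functional on U_q is determined by its values on words. Put h = iwm. On functions q of an integer
  l, letting K shift l by 1, B multiply by h(l + s), M by m, and T act as
  u + (K + K^-1 - 2)/(2 w^2 m) defines a right U_q-module. Its matrix coefficients E_l (s = 0, start at
  the constant function 1, evaluate at l) satisfy E_0 = phi and K.E_l = E_(l+1). Write E'_i for the same
  functionals with (-m, -u) in place of (m, u). In the tensor product module, E'_i E_j depends only on
  j - i and is counit for i = j, so E'_0 is the inverse of phi, the powers of chi are E'_0 E_l, and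
  phi chi^l = E_l. The E_l are independent because B has the distinct eigenvalues h l on them, and
  E_l^* = E'_(-l-1), which gives the form. The modified action of a word on E_l is the module action
  with s = 1/2. Well-definedness of phi and v rests on the monomials I^a K^l T^c N^d spanning U_q.
*)

theory Submission
  imports Defs "HOL-Computational_Algebra.Polynomial"
begin

section \<open>Linear functionals on the free algebra\<close>

text \<open>Right modules appear because the left regular action \<open>(X.f)(Y) = f(YX)\<close>
  appends letters. Under \<open>fold\<close> the last letter of a word acts outermost, so appending
  a letter only moves the index \<open>l\<close> of a coefficient; the action on functionals and the
  module on indices then obey the same formulas. The coefficient t = 1/(2 w^2 m) of T is forced by
  the commutator of B and T: the values h(l + s) of B change by h under a shift, so B and t(K +
  K^-1) have commutator t h (K - K^-1), and t h must be i/(2w). The summand -2 makes constants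
  eigenvectors of T with eigenvalue u, as the values of \<open>phi\<close> demand. The value s = 1/2
  is tied to unitarity. The form pairs index l with n = -l-1, and h is imaginary, so
  self-adjointness of B asks for n + s = -(l + s), that is 2s = 1 for real s.\<close>

abbreviation wd :: "gen list \<Rightarrow> falg" where
  "wd xs \<equiv> Poly_Mapping.single (Word xs) 1"

text \<open>Common shape of \<open>lf\<close>, \<open>keysum2\<close>, \<open>hom_ext\<close>,
  \<open>antipode\<close> and \<open>star\<close>, so that additivity is shown once. The summand is
  an arbitrary function of the coefficient, which admits the conjugation in
  \<open>star\<close>.\<close>

definition keysum :: "('a \<Rightarrow> 'b::zero \<Rightarrow> 'c::comm_monoid_add) \<Rightarrow> ('a \<Rightarrow>\<^sub>0 'b) \<Rightarrow> 'c" where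
  "keysum f X = (\<Sum>x\<in>Poly_Mapping.keys X. f x (Poly_Mapping.lookup X x))"

lemma keysum_superset:
  assumes "finite S" "Poly_Mapping.keys X \<subseteq> S" "\<And>x. f x 0 = 0"
  shows "keysum f X = (\<Sum>x\<in>S. f x (Poly_Mapping.lookup X x))"
  unfolding keysum_def
  by (rule sum.mono_neutral_left) (use assms in \<open>auto simp: in_keys_iff\<close>)

lemma keysum_add:
  fixes f :: "'a \<Rightarrow> 'b::monoid_add \<Rightarrow> 'c::comm_monoid_add"
  assumes "\<And>x. f x 0 = 0" "\<And>x a b. f x (a + b) = f x a + f x b"
  shows "keysum f (X + Y) = keysum f X + keysum f Y"
proof -
  let ?S = "Poly_Mapping.keys X \<union> Poly_Mapping.keys Y"
  have "keysum f Z = (\<Sum>x\<in>?S. f x (Poly_Mapping.lookup Z x))" if "Poly_Mapping.keys Z \<subseteq> ?S" for Z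
    by (rule keysum_superset) (use that assms in auto)
  then show ?thesis
    using keys_add[of X Y] by (simp add: lookup_add assms sum.distrib)
qed

lemma keysum_single: "f x 0 = 0 \<Longrightarrow> keysum f (Poly_Mapping.single x c) = f x c"
  by (simp add: keysum_def)

lemma keysum_zero [simp]: "keysum f 0 = 0"
  by (simp add: keysum_def)

lemma poly_mapping_add_induct [case_names zero single add]:
  fixes X :: "'a \<Rightarrow>\<^sub>0 'b::comm_monoid_add"
  assumes "P 0" "\<And>k c. P (Poly_Mapping.single k c)" "\<And>X Y. P X \<Longrightarrow> P Y \<Longrightarrow> P (X + Y)"
  shows "P X"
proof -
  have "X = (\<Sum>k\<in>Poly_Mapping.keys X. Poly_Mapping.single k (Poly_Mapping.lookup X k))"
    by (rule poly_mapping_eqI)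
      (auto simp: lookup_sum lookup_single when_def in_keys_iff sum.If_cases Int_def cong: conj_cong)
  moreover have "P (\<Sum>k\<in>A. Poly_Mapping.single k (Poly_Mapping.lookup X k))" if "finite A" for A
    using that by (induction A rule: finite_induct) (auto intro: assms)
  ultimately show ?thesis by (metis finite_keys)
qed

lemma smul_single [simp]: "smul c (Poly_Mapping.single k d) = Poly_Mapping.single k (c * d)"
  by (simp add: smul_def mult_single)

lemma smul_add: "smul c (X + Y) = smul c X + smul c Y"
  and smul_diff: "smul c (X - Y) = smul c X - smul c Y"
  and smul_smul [simp]: "smul c (smul d X) = smul (c * d) X"
  and smul_one [simp]: "smul 1 X = X"
  and smul_zero [simp]: "smul c 0 = 0"
  and smul_zero_left [simp]: "smul 0 X = 0"
  and smul_minus_one: "smul (- 1) X = - X"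
  and smul_uminus: "smul (- c) X = - smul c X"
  and smul_mult_left: "smul c X * Y = smul c (X * Y)"
  and smul_add_left: "smul (c + d) X = smul c X + smul d X"
  and smul_mult_right: "X * smul c Y = smul c (X * Y)"
proof -
  show "smul c (smul d X) = smul (c * d) X"
    by (simp add: smul_def mult.assoc[symmetric] mult_single)
  show "smul (- 1) X = - X"
    unfolding smul_def by (simp add: single_uminus)
  show "smul (- c) X = - smul c X"
    unfolding smul_def by (simp add: single_uminus)
  have "X * smul c Y = smul c X * Y"
    by (induction X rule: poly_mapping_add_induct)
      (simp_all add: smul_def distrib_left distrib_right mult_single mult.assoc[symmetric] mult.commute)
  then show "X * smul c Y = smul c (X * Y)"
    by (simp add: smul_def mult.assoc)
qed (simp_all add: smul_def distrib_left right_diff_distrib mult.assoc single_add distrib_right)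

text \<open>The zero element is reached as \<open>smul 0 (wd [])\<close>; identities between linear
  expressions thus reduce to words.\<close>

lemma falg_induct [case_names word smul add]:
  assumes "\<And>xs. P (wd xs)" "\<And>c X. P X \<Longrightarrow> P (smul c X)" "\<And>X Y. P X \<Longrightarrow> P Y \<Longrightarrow> P (X + Y)"
  shows "P X"
proof (induction X rule: poly_mapping_add_induct)
  case zero
  have "P (smul 0 (wd []))" by (rule assms(2)[OF assms(1)])
  then show ?case by simp
next
  case (single k c)
  have "P (smul c (wd (letters k)))" by (rule assms(2)[OF assms(1)])
  then show ?case by simp
qed (rule assms)

lemma wd_mult [simp]: "wd xs * wd ys = wd (xs @ ys)"
  by (simp add: mult_single plus_word_def)

lemma one_eq_wd: "1 = wd []"
  by (metis single_one zero_word_def)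

lemma generators_eq_wd:
  "Kq = wd [GenK]" "Kinvq = wd [GenKinv]" "Bq = wd [GenB]" "Mq = wd [GenM]" "Tq = wd [GenT]"
  by (simp_all add: Kq_def Kinvq_def Bq_def Mq_def Tq_def letter_def)

definition lf :: "(gen list \<Rightarrow> complex) \<Rightarrow> falg \<Rightarrow> complex" where
  "lf F = keysum (\<lambda>x c. c * F (letters x))"

lemma lf_wd [simp]: "lf F (wd xs) = F xs"
  by (simp add: lf_def keysum_single)

lemma lf_add [simp]: "lf F (X + Y) = lf F X + lf F Y"
  unfolding lf_def by (rule keysum_add) (auto simp: distrib_right)

lemma lf_zero [simp]: "lf F 0 = 0"
  by (simp add: lf_def)

lemma lf_smul [simp]: "lf F (smul c X) = c * lf F X"
proof (induction X rule: poly_mapping_add_induct)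
  case (single k d)
  then show ?case by (simp add: lf_def keysum_single)
qed (simp_all add: smul_add distrib_left)

lemma lf_uminus [simp]: "lf F (- X) = - lf F X"
  by (metis lf_smul smul_minus_one mult_minus1)

lemma lf_diff [simp]: "lf F (X - Y) = lf F X - lf F Y"
  using lf_add[of F X "- Y"] by simp

lemma lf_eqI:
  assumes "\<And>xs. f (wd xs) = g (wd xs)"
    "\<And>X Y. f (X + Y) = f X + f Y" "\<And>c X. f (smul c X) = c * f X"
    "\<And>X Y. g (X + Y) = g X + g Y" "\<And>c X. g (smul c X) = c * g X"
  shows "f X = (g X :: complex)"
  by (induction X rule: falg_induct) (simp_all add: assms)

lemma vector_space_smul: "vector_space (smul :: complex \<Rightarrow> ('a::monoid_add \<Rightarrow>\<^sub>0 complex) \<Rightarrow> _)"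
  by standard (simp_all add: smul_add smul_add_left)

lemma linear_lf: "Vector_Spaces.linear smul (*) (lf F)"
proof -
  have "vector_space ((*) :: complex \<Rightarrow> complex \<Rightarrow> complex)"
    by standard (simp_all add: algebra_simps)
  then show ?thesis
    by (simp add: Vector_Spaces.linear_iff vector_space_smul)
qed

lemma linear_eq_lf:
  assumes "Vector_Spaces.linear smul (*) f"
  shows "f = lf (\<lambda>xs. f (wd xs))"
proof
  show "f X = lf (\<lambda>xs. f (wd xs)) X" for X
    by (rule lf_eqI) (use assms in \<open>simp_all add: Vector_Spaces.linear_iff\<close>)
qed

lemma lf_plus: "lf F + lf G = lf (\<lambda>xs. F xs + G xs)"
  by (rule ext, rule lf_eqI) (simp_all add: distrib_left)

lemma lf_minus: "lf F - lf G = lf (\<lambda>xs. F xs - G xs)"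
  by (rule ext, rule lf_eqI) (simp_all add: algebra_simps)

lemma fscale_lf: "fscale c (lf F) = lf (\<lambda>xs. c * F xs)"
  by (rule ext, rule lf_eqI) (simp_all add: distrib_left fscale_def)

section \<open>Sums over the coproduct and the convolution monoid\<close>

text \<open>Sweedler sums of a letter and, through \<open>csum\<close>, of a word: multiplicativity
  of the coproduct becomes recursion over the word. After \<open>sweedler_eq_lf\<close> all
  calculations take place on pairs of words instead of in the tensor square.\<close>

fun cgen :: "gen \<Rightarrow> (gen list \<Rightarrow> gen list \<Rightarrow> complex) \<Rightarrow> complex" where
  "cgen GenK \<beta> = \<beta> [GenK] [GenK]"
| "cgen GenKinv \<beta> = \<beta> [GenKinv] [GenKinv]"
| "cgen GenM \<beta> = \<beta> [GenM] [GenK] + \<beta> [GenKinv] [GenM]"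
| "cgen GenT \<beta> = \<beta> [GenT] [] + \<beta> [] [GenT]"
| "cgen GenB \<beta> = \<beta> [GenB] [GenK] + \<beta> [GenKinv] [GenB]"

primrec csum :: "gen list \<Rightarrow> (gen list \<Rightarrow> gen list \<Rightarrow> complex) \<Rightarrow> complex" where
  "csum [] \<beta> = \<beta> [] []"
| "csum (g # xs) \<beta> = cgen g (\<lambda>c d. csum xs (\<lambda>a b. \<beta> (c @ a) (d @ b)))"

definition keysum2 :: "(gen list \<Rightarrow> gen list \<Rightarrow> complex) \<Rightarrow> falg2 \<Rightarrow> complex" where
  "keysum2 \<beta> = keysum (\<lambda>z c. c * \<beta> (letters (fst z)) (letters (snd z)))"

lemma keysum2_add: "keysum2 \<beta> (X + Y) = keysum2 \<beta> X + keysum2 \<beta> Y"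
  unfolding keysum2_def by (rule keysum_add) (auto simp: distrib_right)

lemma keysum2_single: "keysum2 \<beta> (Poly_Mapping.single z c) = c * \<beta> (letters (fst z)) (letters (snd z))"
  by (simp add: keysum2_def keysum_single)

lemma keysum2_zero [simp]: "keysum2 \<beta> 0 = 0"
  by (simp add: keysum2_def)

lemma keysum2_smul: "keysum2 \<beta> (smul c X) = c * keysum2 \<beta> X"
  by (induction X rule: poly_mapping_add_induct)
    (simp_all add: smul_add keysum2_add keysum2_single distrib_left)

lemma keysum2_single_mult:
  "keysum2 \<beta> (Poly_Mapping.single (Word c, Word d) 1 * X) = keysum2 (\<lambda>a b. \<beta> (c @ a) (d @ b)) X"
  by (induction X rule: poly_mapping_add_induct)
    (simp_all add: distrib_left keysum2_add keysum2_single mult_single plus_word_def split: prod.splits)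

lemma tens_wd: "tens (wd xs) (wd ys) = Poly_Mapping.single (Word xs, Word ys) 1"
  by (simp add: tens_def)

lemma keysum2_coprod_gen_mult:
  "keysum2 \<beta> (coprod_gen g * X) = cgen g (\<lambda>c d. keysum2 (\<lambda>a b. \<beta> (c @ a) (d @ b)) X)"
  by (cases g)
    (simp_all add: generators_eq_wd one_eq_wd tens_wd distrib_right keysum2_add keysum2_single_mult)

lemma hom_ext_keysum:
  "hom_ext h = keysum (\<lambda>x c. smul c (prod_list (map h (letters x))))"
  by (simp add: hom_ext_def keysum_def fun_eq_iff)

lemma coprod_add: "coprod (X + Y) = coprod X + coprod Y"
  unfolding coprod_def hom_ext_keysum by (rule keysum_add) (auto simp: smul_add_left)

lemma coprod_single: "coprod (Poly_Mapping.single x c) = smul c (prod_list (map coprod_gen (letters x)))"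
  unfolding coprod_def hom_ext_keysum by (rule keysum_single) auto

lemma coprod_smul: "coprod (smul c X) = smul c (coprod X)"
proof (induction X rule: poly_mapping_add_induct)
  case zero
  show ?case by (simp add: coprod_def hom_ext_keysum)
qed (simp_all add: smul_add coprod_add coprod_single)

lemma sweedler_keysum2: "sweedler X \<beta> = keysum2 (\<lambda>a b. \<beta> (wd a) (wd b)) (coprod X)"
  by (simp add: sweedler_def keysum2_def keysum_def case_prod_beta)

lemma keysum2_coprod_word:
  "keysum2 \<beta> (prod_list (map coprod_gen xs)) = csum xs \<beta>"
proof (induction xs arbitrary: \<beta>)
  case Nil
  have "(1 :: falg2) = Poly_Mapping.single (Word [], Word []) 1"
    by (simp flip: single_one add: zero_prod_def zero_word_def)
  then show ?case using keysum2_single[of \<beta> "(Word [], Word [])" 1] by simp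
qed (simp add: keysum2_coprod_gen_mult)

lemma sweedler_eq_lf: "sweedler X \<beta> = lf (\<lambda>xs. csum xs (\<lambda>a b. \<beta> (wd a) (wd b))) X"
  by (rule lf_eqI)
    (simp_all add: sweedler_keysum2 coprod_add coprod_smul keysum2_add keysum2_smul coprod_single
      keysum2_coprod_word)

lemma csum_add: "csum xs (\<lambda>a b. \<beta> a b + \<gamma> a b) = csum xs \<beta> + csum xs \<gamma>"
proof (induction xs arbitrary: \<beta> \<gamma>)
  case (Cons g xs)
  then show ?case by (cases g) (simp_all add: algebra_simps)
qed simp

lemma csum_mult: "csum xs (\<lambda>a b. c * \<beta> a b) = c * csum xs \<beta>"
proof (induction xs arbitrary: \<beta>)
  case (Cons g xs)
  then show ?case by (cases g) (simp_all add: algebra_simps)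
qed simp

lemma csum_zero [simp]: "csum xs (\<lambda>a b. 0) = 0"
  using csum_mult[of xs 0 "\<lambda>a b. 0"] by simp

lemma csum_diff: "csum xs (\<lambda>a b. \<beta> a b - \<gamma> a b) = csum xs \<beta> - csum xs \<gamma>"
  using csum_add[of xs \<beta> "\<lambda>a b. - 1 * \<gamma> a b"] unfolding csum_mult by simp

text \<open>Multiplicativity of the coproduct read from the other end. It matches coefficients such
  as \<open>ecoef\<close> and \<open>vcoef\<close>, which unfold at the last letter.\<close>

lemma csum_snoc: "csum (xs @ [g]) \<beta> = cgen g (\<lambda>c d. csum xs (\<lambda>a b. \<beta> (a @ c) (b @ d)))"
proof (induction xs arbitrary: \<beta> g)
  case (Cons x xs)
  show ?case by (cases x; cases g) (simp_all add: Cons algebra_simps)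
qed simp

lemma csum_coassoc:
  "csum xs (\<lambda>a b. csum a (\<lambda>c d. \<gamma> c d b)) = csum xs (\<lambda>a b. csum b (\<lambda>c d. \<gamma> a c d))"
proof (induction xs arbitrary: \<gamma>)
  case (Cons x xs)
  have *: "csum xs (\<lambda>a b. csum a (\<lambda>c d. \<gamma> (p @ c) (q @ d) (r @ b)))
    = csum xs (\<lambda>a b. csum b (\<lambda>c d. \<gamma> (p @ a) (q @ c) (r @ d)))" for p q r
    by (rule Cons)
  show ?case
    \<comment> \<open>The prefixes are the terms of the iterated coproduct of one letter: one term
      for \<open>K\<close> and its inverse, three for \<open>M\<close> and \<open>B\<close>, three
      for \<open>T\<close>.\<close>
    using *[of "[x]" "[x]" "[x]"] *[of "[x]" "[GenK]" "[GenK]"] *[of "[GenKinv]" "[x]" "[GenK]"]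
      *[of "[GenKinv]" "[GenKinv]" "[x]"] *[of "[x]" "[]" "[]"] *[of "[]" "[x]" "[]"] *[of "[]" "[]" "[x]"]
    by (cases x) (simp_all add: csum_add)
qed simp

definition counit_word :: "gen list \<Rightarrow> complex" where
  "counit_word xs = prod_list (map counit_gen xs)"

lemma counit_word_simps [simp]:
  "counit_word [] = 1" "counit_word (g # xs) = counit_gen g * counit_word xs"
  "counit_word (xs @ ys) = counit_word xs * counit_word ys"
  by (simp_all add: counit_word_def)

lemma counit_eq_lf: "counit = lf counit_word"
  by (simp add: counit_def lf_def keysum_def fun_eq_iff counit_word_def)

lemma csum_counit_left: "csum xs (\<lambda>a b. counit_word a * F b) = F xs"
proof (induction xs arbitrary: F)
  case (Cons x xs)
  show ?case
    using Cons[of "\<lambda>xs. F (x # xs)"] by (cases x) (simp_all add: mult.assoc csum_mult)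
qed simp

lemma csum_counit_right: "csum xs (\<lambda>a b. F a * counit_word b) = F xs"
proof (induction xs arbitrary: F)
  case (Cons x xs)
  show ?case
    using Cons[of "\<lambda>xs. F (x # xs)"] by (cases x) (simp_all add: mult.assoc csum_mult)
qed simp

lemma conv_eq_lf: "f \<star> g = lf (\<lambda>xs. csum xs (\<lambda>a b. f (wd a) * g (wd b)))"
  by (simp add: conv_def sweedler_eq_lf fun_eq_iff)

lemma conv_lf: "lf F \<star> lf G = lf (\<lambda>xs. csum xs (\<lambda>a b. F a * G b))"
  by (simp add: conv_eq_lf)

lemma conv_assoc: "(f \<star> g) \<star> h = f \<star> (g \<star> h)"
  using csum_coassoc[of _ "\<lambda>a b c. f (wd a) * (g (wd b) * h (wd c))"]
  by (simp add: conv_eq_lf csum_mult[symmetric] mult.assoc mult.commute[of "csum _ _"])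
     (simp add: ac_simps)

lemma conv_counit_left: "counit \<star> lf F = lf F"
  by (simp add: counit_eq_lf conv_lf csum_counit_left)

lemma conv_counit_right: "lf F \<star> counit = lf F"
  by (simp add: counit_eq_lf conv_lf csum_counit_right)

lemma conv_add_left: "(f + g) \<star> h = f \<star> h + g \<star> h"
  and conv_add_right: "h \<star> (f + g) = h \<star> f + h \<star> g"
  and conv_diff_left: "(f - g) \<star> h = f \<star> h - g \<star> h"
  and conv_diff_right: "h \<star> (f - g) = h \<star> f - h \<star> g"
  and conv_fscale_left: "fscale c f \<star> h = fscale c (f \<star> h)"
  and conv_fscale_right: "h \<star> fscale c f = fscale c (h \<star> f)"
  by (simp_all add: conv_eq_lf lf_plus lf_minus fscale_lf algebra_simps csum_add csum_diff
    csum_mult[symmetric]) (simp_all add: fscale_def ac_simps)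

section \<open>The defining ideal and the spanning monomials\<close>

lemma ring_free_ring: "ring free_ring"
proof -
  have "\<exists>y. y + x = (0 :: falg)" for x
    by (rule exI[of _ "- x"]) simp
  then show ?thesis
    unfolding free_ring_def
    by (intro ringI abelian_groupI monoidI) (auto simp: algebra_simps)
qed

lemma idealI_free_ring:
  assumes "0 \<in> I" "\<And>X Y. X \<in> I \<Longrightarrow> Y \<in> I \<Longrightarrow> X + Y \<in> I"
    "\<And>X Y. X \<in> I \<Longrightarrow> Y * X \<in> I" "\<And>X Y. X \<in> I \<Longrightarrow> X * Y \<in> I"
  shows "ideal I free_ring"
proof (rule idealI[OF ring_free_ring])
  interpret ring free_ring by (rule ring_free_ring)
  have "- X \<in> I" if "X \<in> I" for X using assms(3)[OF that, of "- 1"] by simp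
  moreover have "\<ominus>\<^bsub>free_ring\<^esub> X = - X" for X
    by (rule minus_equality) (simp_all add: free_ring_def)
  ultimately show "subgroup I (add_monoid free_ring)"
    using assms by (intro add.subgroupI) (auto simp: free_ring_def a_inv_def)
qed (use assms in \<open>auto simp: free_ring_def\<close>)

lemma ideal_galilei_ideal: "ideal (galilei_ideal w) free_ring"
  unfolding galilei_ideal_def
  by (rule ring.genideal_ideal[OF ring_free_ring]) (simp add: free_ring_def)

lemma galilei_ideal_closed:
  shows galilei_ideal_zero: "0 \<in> galilei_ideal w"
    and galilei_ideal_add: "X \<in> galilei_ideal w \<Longrightarrow> Y \<in> galilei_ideal w \<Longrightarrow> X + Y \<in> galilei_ideal w"
    and galilei_ideal_mult_left: "X \<in> galilei_ideal w \<Longrightarrow> Z * X \<in> galilei_ideal w"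
    and galilei_ideal_mult_right: "X \<in> galilei_ideal w \<Longrightarrow> X * Z \<in> galilei_ideal w"
proof -
  interpret ideal "galilei_ideal w" free_ring by (rule ideal_galilei_ideal)
  show "0 \<in> galilei_ideal w" using additive_subgroup.zero_closed[OF is_additive_subgroup] by (simp add: free_ring_def)
  show "X + Y \<in> galilei_ideal w" if "X \<in> galilei_ideal w" "Y \<in> galilei_ideal w"
    using additive_subgroup.a_closed[OF is_additive_subgroup that] by (simp add: free_ring_def)
  show "Z * X \<in> galilei_ideal w" if "X \<in> galilei_ideal w"
    using I_l_closed[OF that, of Z] by (simp add: free_ring_def)
  show "X * Z \<in> galilei_ideal w" if "X \<in> galilei_ideal w"
    using I_r_closed[OF that, of Z] by (simp add: free_ring_def)
qed

lemma galilei_ideal_smul: "X \<in> galilei_ideal w \<Longrightarrow> smul c X \<in> galilei_ideal w"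
  by (simp add: smul_def galilei_ideal_mult_left)

lemma relators_in_galilei_ideal: "relators w \<subseteq> galilei_ideal w"
  unfolding galilei_ideal_def
  by (rule ring.genideal_self[OF ring_free_ring]) (simp add: free_ring_def)

lemma galilei_ideal_induct [consumes 1, case_names relator zero add left right]:
  assumes "X \<in> galilei_ideal w"
    and "\<And>r. r \<in> relators w \<Longrightarrow> P r" "P 0" "\<And>X Y. P X \<Longrightarrow> P Y \<Longrightarrow> P (X + Y)"
    "\<And>X Y. P X \<Longrightarrow> P (Y * X)" "\<And>X Y. P X \<Longrightarrow> P (X * Y)"
  shows "P X"
proof -
  have "ideal {X. P X} free_ring"
    by (rule idealI_free_ring) (use assms in auto)
  then have "galilei_ideal w \<subseteq> {X. P X}"
    unfolding galilei_ideal_def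
    by (rule ring.genideal_minimal[OF ring_free_ring]) (use assms in auto)
  then show ?thesis using assms(1) by auto
qed

section \<open>Congruence calculus modulo the defining ideal\<close>

definition galilei_cong :: "real \<Rightarrow> falg \<Rightarrow> falg \<Rightarrow> bool" where
  "galilei_cong w X Y \<longleftrightarrow> X - Y \<in> galilei_ideal w"

lemma galilei_cong_refl [simp]: "galilei_cong w X X"
  by (simp add: galilei_cong_def galilei_ideal_zero)

lemma galilei_cong_sym: "galilei_cong w X Y \<Longrightarrow> galilei_cong w Y X"
  using galilei_ideal_mult_left[of "X - Y" w "- 1"] by (simp add: galilei_cong_def)

lemma galilei_cong_trans [trans]:
  "galilei_cong w X Y \<Longrightarrow> galilei_cong w Y Z \<Longrightarrow> galilei_cong w X Z"
  using galilei_ideal_add[of "X - Y" w "Y - Z"] by (simp add: galilei_cong_def)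

lemma galilei_cong_mult_left: "galilei_cong w X Y \<Longrightarrow> galilei_cong w (Z * X) (Z * Y)"
  using galilei_ideal_mult_left[of "X - Y" w Z] by (simp add: galilei_cong_def algebra_simps)

lemma galilei_cong_mult_right: "galilei_cong w X Y \<Longrightarrow> galilei_cong w (X * Z) (Y * Z)"
  using galilei_ideal_mult_right[of "X - Y" w Z] by (simp add: galilei_cong_def algebra_simps)

lemma galilei_cong_add:
  "galilei_cong w X Y \<Longrightarrow> galilei_cong w X' Y' \<Longrightarrow> galilei_cong w (X + X') (Y + Y')"
  using galilei_ideal_add[of "X - Y" w "X' - Y'"] by (simp add: galilei_cong_def algebra_simps)

lemma galilei_cong_smul: "galilei_cong w X Y \<Longrightarrow> galilei_cong w (smul c X) (smul c Y)"
  using galilei_ideal_smul[of "X - Y" w c] by (simp add: galilei_cong_def smul_diff)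

lemma galilei_relations:
  shows K_Kinv: "galilei_cong w (Kq * Kinvq) 1"
    and Kinv_K: "galilei_cong w (Kinvq * Kq) 1"
    and M_central: "X \<in> {Kq, Kinvq, Bq, Tq} \<Longrightarrow> galilei_cong w (Mq * X) (X * Mq)"
    and K_T: "galilei_cong w (Kq * Tq) (Tq * Kq)"
    and K_B_Kinv: "galilei_cong w (Kq * Bq * Kinvq) (Bq - smul (\<i> * of_real w) Mq)"
    and B_T: "galilei_cong w (Bq * Tq) (Tq * Bq + smul (\<i> / (2 * of_real w)) (Kq - Kinvq))"
proof -
  have *: "galilei_cong w X Y" if "X - Y \<in> relators w" for X Y
    using that relators_in_galilei_ideal by (auto simp: galilei_cong_def)
  show "galilei_cong w (Bq * Tq) (Tq * Bq + smul (\<i> / (2 * of_real w)) (Kq - Kinvq))"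
    by (rule *) (simp add: relators_def diff_diff_eq[symmetric])
  show "galilei_cong w (Mq * X) (X * Mq)" if "X \<in> {Kq, Kinvq, Bq, Tq}"
    by (rule *) (use that in \<open>auto simp: relators_def\<close>)
  show "galilei_cong w (Kq * Kinvq) 1" "galilei_cong w (Kinvq * Kq) 1"
    "galilei_cong w (Kq * Tq) (Tq * Kq)"
    "galilei_cong w (Kq * Bq * Kinvq) (Bq - smul (\<i> * of_real w) Mq)"
    by (rule *, simp add: relators_def)+
qed

lemma galilei_cong_cancel:
  "galilei_cong w (Z * Z') 1 \<Longrightarrow> galilei_cong w (X * Z * Z') X"
  "galilei_cong w (Z * Z') 1 \<Longrightarrow> galilei_cong w (Z * (Z' * X)) X"
  using galilei_cong_mult_left[of w "Z * Z'" 1 X] galilei_cong_mult_right[of w "Z * Z'" 1 X]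
  by (simp_all add: mult.assoc)

definition commutes_mod :: "real \<Rightarrow> falg \<Rightarrow> falg \<Rightarrow> bool" where
  "commutes_mod w X P \<longleftrightarrow> galilei_cong w (X * P) (P * X)"

lemma commutes_mod_mult:
  assumes "commutes_mod w X P" "commutes_mod w X Q"
  shows "commutes_mod w X (P * Q)"
  using galilei_cong_trans[OF galilei_cong_mult_right[of w "X * P" "P * X" Q]
      galilei_cong_mult_left[of w "X * Q" "Q * X" P, simplified mult.assoc[symmetric]]] assms
  by (simp add: commutes_mod_def mult.assoc)

lemma commutes_mod_sym: "commutes_mod w X P \<Longrightarrow> commutes_mod w P X"
  by (simp add: commutes_mod_def galilei_cong_sym)

lemma commutes_mod_one: "commutes_mod w X 1"
  by (simp add: commutes_mod_def)

lemma commutes_mod_power: "commutes_mod w X P \<Longrightarrow> commutes_mod w X (P ^ n)"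
  by (induction n) (simp_all add: commutes_mod_one commutes_mod_mult)

lemma commutes_mod_Kinv:
  assumes "commutes_mod w X Kq"
  shows "commutes_mod w X Kinvq"
proof -
  have "galilei_cong w (X * Kinvq) (Kinvq * Kq * X * Kinvq)"
    using galilei_cong_mult_right[OF Kinv_K, of w "X * Kinvq"] by (auto simp: mult.assoc intro: galilei_cong_sym)
  also have "galilei_cong w \<dots> (Kinvq * X * Kq * Kinvq)"
    using galilei_cong_mult_right[OF galilei_cong_mult_left[OF assms[unfolded commutes_mod_def], of Kinvq], of Kinvq]
    by (auto simp: mult.assoc intro: galilei_cong_sym)
  also have "galilei_cong w \<dots> (Kinvq * X)"
    by (rule galilei_cong_cancel) (rule K_Kinv)
  finally show ?thesis by (simp add: commutes_mod_def)
qed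

lemma commutes_mod_generators:
  "commutes_mod w Mq Kq" "commutes_mod w Mq Kinvq" "commutes_mod w Mq Bq" "commutes_mod w Mq Tq"
  "commutes_mod w Kq Tq" "commutes_mod w Tq Kinvq" "commutes_mod w Kq Kinvq"
  by (auto simp: commutes_mod_def intro: M_central K_T commutes_mod_Kinv[unfolded commutes_mod_def]
    galilei_cong_sym[OF K_T])

lemma commutes_mod_Kpow: "commutes_mod w X Kq \<Longrightarrow> commutes_mod w X (Kpow l)"
  by (simp add: Kpow_def commutes_mod_power commutes_mod_Kinv)

text \<open>The commutator of \<open>B\<close> with \<open>P\<close> is \<open>c P M\<close> modulo
  the ideal. Commutation with \<open>M\<close> is included so that products work: the
  \<open>M\<close> produced by the left factor must pass the right one. Weights then add, and
  \<open>B\<close> crosses any monomial in \<open>K\<close>, its inverse and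
  \<open>M\<close>.\<close>

definition B_weight :: "real \<Rightarrow> falg \<Rightarrow> complex \<Rightarrow> bool" where
  "B_weight w P c \<longleftrightarrow> commutes_mod w Mq P \<and> galilei_cong w (Bq * P) (P * Bq + smul c (P * Mq))"

lemma B_weight_mult:
  assumes "B_weight w P c" "B_weight w Q d"
  shows "B_weight w (P * Q) (c + d)"
proof -
  have "galilei_cong w (Bq * (P * Q)) (P * (Bq * Q) + smul c (P * (Mq * Q)))"
    using galilei_cong_mult_right[of w "Bq * P" "P * Bq + smul c (P * Mq)" Q] assms(1)
    by (simp add: B_weight_def distrib_right smul_mult_left mult.assoc)
  also have "galilei_cong w \<dots> (P * (Q * Bq + smul d (Q * Mq)) + smul c (P * (Q * Mq)))"
    using assms(2) by (intro galilei_cong_add galilei_cong_smul galilei_cong_mult_left)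
      (simp_all add: B_weight_def commutes_mod_def)
  finally show ?thesis
    using assms by (simp add: B_weight_def commutes_mod_mult distrib_left smul_mult_right mult.assoc
      smul_add_left add.commute add.left_commute)
qed

lemma B_weight_one: "B_weight w 1 0"
  by (simp add: B_weight_def commutes_mod_one)

lemma B_weight_power: "B_weight w P c \<Longrightarrow> \<exists>d. B_weight w (P ^ n) d"
  by (induction n) (auto intro: B_weight_one B_weight_mult)

lemma B_weight_Kinv: "B_weight w Kinvq (- (\<i> * of_real w))"
proof -
  have "galilei_cong w (Bq * Kinvq) (Kinvq * (Kq * (Bq * Kinvq)))"
    by (rule galilei_cong_sym, rule galilei_cong_cancel, rule Kinv_K)
  also have "galilei_cong w \<dots> (Kinvq * (Bq - smul (\<i> * of_real w) Mq))"
    using galilei_cong_mult_left[OF K_B_Kinv, of w Kinvq] by (simp add: mult.assoc)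
  finally show ?thesis
    by (simp add: B_weight_def commutes_mod_generators smul_mult_right right_diff_distrib smul_uminus)
qed

lemma B_weight_K: "B_weight w Kq (\<i> * of_real w)"
proof -
  let ?z = "\<i> * of_real w :: complex"
  have "galilei_cong w (Kq * Bq) (Kq * Bq * Kinvq * Kq)"
    by (rule galilei_cong_sym, rule galilei_cong_cancel, rule Kinv_K)
  also have "galilei_cong w \<dots> ((Bq - smul ?z Mq) * Kq)"
    by (rule galilei_cong_mult_right, rule K_B_Kinv)
  also have "\<dots> = Bq * Kq - smul ?z (Mq * Kq)"
    by (simp add: left_diff_distrib smul_mult_left)
  finally have "galilei_cong w (Kq * Bq + smul ?z (Mq * Kq)) (Bq * Kq)"
    by (simp add: galilei_cong_def algebra_simps)
  moreover have "galilei_cong w (Kq * Bq + smul ?z (Kq * Mq)) (Kq * Bq + smul ?z (Mq * Kq))"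
    by (intro galilei_cong_add galilei_cong_smul galilei_cong_refl)
      (rule galilei_cong_sym, rule M_central, simp)
  ultimately show ?thesis
    unfolding B_weight_def using commutes_mod_generators galilei_cong_sym galilei_cong_trans by blast
qed

lemma B_weight_M: "B_weight w Mq 0"
  using commutes_mod_sym[OF commutes_mod_generators(3)] by (simp add: B_weight_def commutes_mod_def)

section \<open>Spanning by the ordered monomials, via closure under left multiplication by
  generators\<close>

inductive_set pbw_span :: "real \<Rightarrow> falg set" for w where
  pbw: "pbw a l c d \<in> pbw_span w"
| ideal: "X \<in> galilei_ideal w \<Longrightarrow> X \<in> pbw_span w"
| add: "X \<in> pbw_span w \<Longrightarrow> Y \<in> pbw_span w \<Longrightarrow> X + Y \<in> pbw_span w"
| smul: "X \<in> pbw_span w \<Longrightarrow> smul c X \<in> pbw_span w"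

lemma pbw_span_cong: "galilei_cong w X Y \<Longrightarrow> Y \<in> pbw_span w \<Longrightarrow> X \<in> pbw_span w"
  using pbw_span.add[of Y w "X - Y"] by (simp add: galilei_cong_def pbw_span.ideal)

lemma pbw_span_diff: "X \<in> pbw_span w \<Longrightarrow> Y \<in> pbw_span w \<Longrightarrow> X - Y \<in> pbw_span w"
  using pbw_span.add[of X w "smul (-1) Y"] pbw_span.smul[of Y w "-1"] by (simp add: smul_minus_one)

lemma pbw_span_mult_left:
  assumes "\<And>a l c d. Z * pbw a l c d \<in> pbw_span w" "X \<in> pbw_span w"
  shows "Z * X \<in> pbw_span w"
  using assms(2)
  by induction (auto simp: distrib_left smul_mult_right intro: assms(1) pbw_span.intros galilei_ideal_mult_left)

lemma commutes_mod_I: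
  assumes "commutes_mod w X Kq" "commutes_mod w X Mq"
  shows "commutes_mod w X ((Kinvq * Mq) ^ a)"
  using assms by (intro commutes_mod_power commutes_mod_mult commutes_mod_Kinv)

lemma K_mult_Kpow: "galilei_cong w (Kq * Kpow l) (Kpow (l + 1))"
proof (cases "0 \<le> l")
  case True
  then show ?thesis by (simp add: Kpow_def nat_add_distrib power_commutes)
next
  case False
  then obtain n where l: "l = - int (Suc n)" by (metis negD not_le)
  show ?thesis unfolding l using galilei_cong_cancel(2)[OF K_Kinv[of w], of "Kinvq ^ n"]
    by (auto simp: Kpow_def nat_add_distrib)
qed

lemma Kinv_mult_Kpow: "galilei_cong w (Kinvq * Kpow l) (Kpow (l - 1))"
proof (cases "1 \<le> l")
  case True
  then obtain n where l: "l = int (Suc n)"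
    using zero_less_imp_eq_int[of l] by (metis gr0_conv_Suc int_one_le_iff_zero_less of_nat_0_less_iff)
  show ?thesis unfolding l using galilei_cong_cancel(2)[OF Kinv_K[of w], of "Kq ^ n"]
    by (auto simp: Kpow_def nat_add_distrib)
next
  case False
  then have "l \<le> 0" by simp
  then obtain n where l: "l = - int n" by (rule nonpos_int_cases)
  show ?thesis unfolding l by (cases n) (auto simp: Kpow_def nat_add_distrib)
qed

lemma commuting_mult_pbw:
  assumes "commutes_mod w X Kq" "commutes_mod w X Mq"
  shows "galilei_cong w (X * pbw a l c d) ((Kinvq * Mq) ^ a * (X * Kpow l * Tq ^ c * (Kq * Bq) ^ d))"
  using galilei_cong_mult_right[OF commutes_mod_I[OF assms, unfolded commutes_mod_def, of a],
    of "Kpow l * Tq ^ c * (Kq * Bq) ^ d"]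
  by (simp add: pbw_def mult.assoc)

lemma K_pbw: "galilei_cong w (Kq * pbw a l c d) (pbw a (l + 1) c d)"
proof -
  have "commutes_mod w Kq Kq" by (simp add: commutes_mod_def)
  note commuting_mult_pbw[OF this commutes_mod_sym[OF commutes_mod_generators(1)], of a l c d]
  also have "galilei_cong w ((Kinvq * Mq) ^ a * (Kq * Kpow l * Tq ^ c * (Kq * Bq) ^ d)) (pbw a (l + 1) c d)"
    by (simp add: pbw_def mult.assoc[of "(Kinvq * Mq) ^ a"] galilei_cong_mult_left galilei_cong_mult_right K_mult_Kpow)
  finally show ?thesis .
qed

lemma Kinv_pbw: "galilei_cong w (Kinvq * pbw a l c d) (pbw a (l - 1) c d)"
proof -
  have "commutes_mod w Kinvq Kq" "commutes_mod w Kinvq Mq"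
    using commutes_mod_generators commutes_mod_sym by blast+
  note commuting_mult_pbw[OF this, of a l c d]
  also have "galilei_cong w ((Kinvq * Mq) ^ a * (Kinvq * Kpow l * Tq ^ c * (Kq * Bq) ^ d)) (pbw a (l - 1) c d)"
    by (simp add: pbw_def mult.assoc[of "(Kinvq * Mq) ^ a"] galilei_cong_mult_left galilei_cong_mult_right Kinv_mult_Kpow)
  finally show ?thesis .
qed

lemma T_pbw: "galilei_cong w (Tq * pbw a l c d) (pbw a l (Suc c) d)"
proof -
  have T: "commutes_mod w Tq Kq" "commutes_mod w Tq Mq"
    using commutes_mod_generators commutes_mod_sym by blast+
  note commuting_mult_pbw[OF T, of a l c d]
  also have "galilei_cong w ((Kinvq * Mq) ^ a * (Tq * Kpow l * Tq ^ c * (Kq * Bq) ^ d))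
    ((Kinvq * Mq) ^ a * (Kpow l * Tq * Tq ^ c * (Kq * Bq) ^ d))"
    using commutes_mod_Kpow[OF T(1), of l, unfolded commutes_mod_def]
    by (intro galilei_cong_mult_left galilei_cong_mult_right)
  finally show ?thesis by (simp add: pbw_def mult.assoc)
qed

lemma pbw_span_mult_closed:
  assumes "X \<in> pbw_span w"
  shows pbw_span_K: "Kq * X \<in> pbw_span w" and pbw_span_Kinv: "Kinvq * X \<in> pbw_span w"
    and pbw_span_T: "Tq * X \<in> pbw_span w" and pbw_span_I: "(Kinvq * Mq) * X \<in> pbw_span w"
    and pbw_span_M: "Mq * X \<in> pbw_span w"
proof -
  have K: "Kq * Y \<in> pbw_span w" if "Y \<in> pbw_span w" for Y
    using pbw_span_cong[OF K_pbw pbw_span.pbw] that by (rule pbw_span_mult_left)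
  then show "Kq * X \<in> pbw_span w" using assms .
  show "Kinvq * X \<in> pbw_span w"
    using pbw_span_cong[OF Kinv_pbw pbw_span.pbw] assms by (rule pbw_span_mult_left)
  show "Tq * X \<in> pbw_span w"
    using pbw_span_cong[OF T_pbw pbw_span.pbw] assms by (rule pbw_span_mult_left)
  have "(Kinvq * Mq) * pbw a l c d = pbw (Suc a) l c d" for a l c d
    by (simp add: pbw_def mult.assoc)
  then show I: "(Kinvq * Mq) * X \<in> pbw_span w"
    by (metis assms pbw_span_mult_left pbw_span.pbw)
  \<comment> \<open>The ordered monomials contain \<open>I\<close> rather than \<open>M\<close>, so
    \<open>M\<close> is rewritten as \<open>K I\<close>.\<close>
  have "galilei_cong w (Mq * X) (Kq * (Kinvq * (Mq * X)))"
    by (rule galilei_cong_sym, rule galilei_cong_cancel, rule K_Kinv)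
  then show "Mq * X \<in> pbw_span w"
    using K[OF I] by (auto simp: mult.assoc intro: pbw_span_cong)
qed

text \<open>Moving \<open>B\<close> past one \<open>T\<close> leaves a multiple of
  \<open>K - K^-1\<close> in front of a lower power of \<open>T\<close>. Once no \<open>T\<close>
  remains, \<open>B N^d\<close> is \<open>K^-1 N^(d+1)\<close>, again an ordered monomial.\<close>

lemma pbw_span_B_T: "Bq * (Tq ^ c * (Kq * Bq) ^ d) \<in> pbw_span w"
proof (induction c)
  case 0
  have "galilei_cong w (Bq * (Kq * Bq) ^ d) (Kinvq * (Kq * (Bq * (Kq * Bq) ^ d)))"
    by (rule galilei_cong_sym, rule galilei_cong_cancel, rule Kinv_K)
  moreover have "Kinvq * (Kq * (Bq * (Kq * Bq) ^ d)) = pbw 0 (- 1) 0 (Suc d)"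
    by (simp add: pbw_def Kpow_def mult.assoc)
  ultimately show ?case by (simp add: pbw_span_cong pbw_span.pbw)
next
  case (Suc c)
  let ?X = "Tq ^ c * (Kq * Bq) ^ d"
  have X: "?X \<in> pbw_span w"
    using pbw_span.pbw[of 0 0 c d w] by (simp add: pbw_def Kpow_def)
  have "galilei_cong w (Bq * Tq * ?X) ((Tq * Bq + smul (\<i> / (2 * of_real w)) (Kq - Kinvq)) * ?X)"
    by (rule galilei_cong_mult_right, rule B_T)
  moreover have "(Tq * Bq + smul (\<i> / (2 * of_real w)) (Kq - Kinvq)) * ?X \<in> pbw_span w"
    using pbw_span_T[OF Suc] pbw_span_K[OF X] pbw_span_Kinv[OF X]
    by (auto simp: distrib_right smul_mult_left left_diff_distrib mult.assoc
      intro!: pbw_span.add pbw_span.smul pbw_span_diff)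
  ultimately show ?case by (auto simp: mult.assoc intro: pbw_span_cong)
qed

text \<open>The prefix \<open>I^a K^l\<close> has a weight, so \<open>B\<close> crosses it at the
  cost of a multiple of \<open>M\<close>; the remaining product of \<open>B\<close> with
  \<open>T^c N^d\<close> is \<open>pbw_span_B_T\<close>.\<close>

lemma pbw_span_B:
  assumes "X \<in> pbw_span w"
  shows "Bq * X \<in> pbw_span w"
  using _ assms
proof (rule pbw_span_mult_left)
  fix a l c d
  let ?X = "Tq ^ c * (Kq * Bq) ^ d" and ?P = "(Kinvq * Mq) ^ a * Kpow l"
  have X: "?X \<in> pbw_span w"
    using pbw_span.pbw[of 0 0 c d w] by (simp add: pbw_def Kpow_def)
  have P: "?P * Y \<in> pbw_span w" if "Y \<in> pbw_span w" for Y
  proof -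
    have "Kpow l * Y \<in> pbw_span w"
    proof -
      have "Kq ^ n * Y \<in> pbw_span w" "Kinvq ^ n * Y \<in> pbw_span w" for n
        using that by (induction n) (auto simp: mult.assoc intro: pbw_span_K pbw_span_Kinv)
      then show ?thesis by (simp add: Kpow_def)
    qed
    then have "(Kinvq * Mq) ^ a * (Kpow l * Y) \<in> pbw_span w"
    proof (induction a)
      case (Suc a)
      then show ?case using pbw_span_I[OF Suc(1)] by (simp add: mult.assoc)
    qed simp
    then show ?thesis by (simp add: mult.assoc)
  qed
  obtain e where e: "B_weight w ((Kinvq * Mq) ^ a) e"
    using B_weight_power[OF B_weight_mult[OF B_weight_Kinv B_weight_M]] by blast
  obtain e' where "B_weight w (Kpow l) e'"
    using B_weight_power[OF B_weight_K, of w "nat l"] B_weight_power[OF B_weight_Kinv, of w "nat (- l)"]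
    by (cases "0 \<le> l") (auto simp: Kpow_def)
  with e have "B_weight w ?P (e + e')" by (rule B_weight_mult)
  then have "galilei_cong w (Bq * ?P * ?X) ((?P * Bq + smul (e + e') (?P * Mq)) * ?X)"
    unfolding B_weight_def by (intro galilei_cong_mult_right) auto
  moreover have "(?P * Bq + smul (e + e') (?P * Mq)) * ?X \<in> pbw_span w"
    using P[OF pbw_span_B_T[of c d]] P[OF pbw_span_M[OF X]]
    by (auto simp: distrib_right smul_mult_left mult.assoc intro!: pbw_span.add pbw_span.smul)
  ultimately show "Bq * pbw a l c d \<in> pbw_span w"
    by (auto simp: pbw_def mult.assoc intro: pbw_span_cong)
qed

lemma pbw_span_UNIV: "X \<in> pbw_span w"
proof (induction X rule: falg_induct)
  case (word xs)
  show ?case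
  proof (induction xs)
    case Nil
    then show ?case using pbw_span.pbw[of 0 0 0 0 w] by (simp add: pbw_def Kpow_def one_eq_wd)
  next
    case (Cons g xs)
    have "wd (g # xs) = wd [g] * wd xs" by simp
    then show ?case
      using Cons pbw_span_mult_closed[OF Cons] pbw_span_B[OF Cons]
      by (cases g) (simp_all add: generators_eq_wd)
  qed
qed (auto intro: pbw_span.intros)

text \<open>The uniqueness half of the definite descriptions \<open>vq\<close> and
  \<open>phi\<close>. Existence comes from the matrix coefficients below.\<close>

lemma Udual_eqI:
  assumes "f \<in> Udual w" "g \<in> Udual w" "\<And>a l c d. f (pbw a l c d) = g (pbw a l c d)"
  shows "f = g"
proof (rule ext)
  fix X
  have f: "\<And>X Y. f (X + Y) = f X + f Y" "\<And>c X. f (smul c X) = c * f X"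
    "\<And>X. X \<in> galilei_ideal w \<Longrightarrow> f X = 0"
    using assms(1) by (auto simp: Udual_def Vector_Spaces.linear_iff)
  have g: "\<And>X Y. g (X + Y) = g X + g Y" "\<And>c X. g (smul c X) = c * g X"
    "\<And>X. X \<in> galilei_ideal w \<Longrightarrow> g X = 0"
    using assms(2) by (auto simp: Udual_def Vector_Spaces.linear_iff)
  show "f X = g X"
    using pbw_span_UNIV[of X w] by induction (simp_all add: f g assms(3))
qed

section \<open>Modules of functions on the integers and their matrix coefficients\<close>

lemma lf_single [simp]: "lf F (Poly_Mapping.single x c) = c * F (letters x)"
  by (simp add: lf_def keysum_single)

type_synonym gen_action = "gen \<Rightarrow> (int \<Rightarrow> complex) \<Rightarrow> (int \<Rightarrow> complex)"

definition linear_action :: "gen_action \<Rightarrow> bool" where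
  "linear_action A \<longleftrightarrow>
    (\<forall>g q r. A g (\<lambda>l. q l + r l) = (\<lambda>l. A g q l + A g r l)) \<and>
    (\<forall>g c q. A g (\<lambda>l. c * q l) = (\<lambda>l. c * A g q l))"

text \<open>Letters act on the right, so that a word \<open>xs\<close> acts as \<open>fold A xs\<close>.\<close>

definition galilei_module :: "real \<Rightarrow> gen_action \<Rightarrow> bool" where
  "galilei_module w A \<longleftrightarrow> linear_action A \<and>
    (\<forall>q. A GenKinv (A GenK q) = q \<and> A GenK (A GenKinv q) = q) \<and>
    (\<forall>g q. A g (A GenM q) = A GenM (A g q)) \<and>
    (\<forall>q. A GenT (A GenK q) = A GenK (A GenT q)) \<and>
    (\<forall>q. A GenKinv (A GenB (A GenK q)) = (\<lambda>l. A GenB q l - \<i> * of_real w * A GenM q l)) \<and>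
    (\<forall>q. (\<lambda>l. A GenT (A GenB q) l - A GenB (A GenT q) l) =
      (\<lambda>l. \<i> / (2 * of_real w) * (A GenK q l - A GenKinv q l)))"

lemma fold_action_add:
  "linear_action A \<Longrightarrow> fold A xs (\<lambda>l. q l + r l) l = fold A xs q l + fold A xs r l"
  by (induction xs arbitrary: q r) (simp_all add: linear_action_def)

lemma fold_action_mult:
  "linear_action A \<Longrightarrow> fold A xs (\<lambda>l. c * q l) l = c * fold A xs q l"
  by (induction xs arbitrary: q) (simp_all add: linear_action_def)

lemma fold_action_diff:
  "linear_action A \<Longrightarrow> fold A xs (\<lambda>l. q l - r l) l = fold A xs q l - fold A xs r l"
proof -
  assume A: "linear_action A"
  have "fold A xs (\<lambda>l. q l + - 1 * r l) l = fold A xs q l + - 1 * fold A xs r l"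
    by (simp only: fold_action_add[OF A] fold_action_mult[OF A])
  then show ?thesis by simp
qed

lemma fold_action_zero: "linear_action A \<Longrightarrow> fold A xs (\<lambda>l. 0) l = 0"
  using fold_action_mult[of A xs 0 "\<lambda>l. 0" l] by simp

text \<open>For a relator between words \<open>a\<close> and \<open>b\<close>, the module relation
  holds at the vector \<open>fold A a q\<close>, and \<open>b\<close> then acts linearly on an
  identity between vectors.\<close>

lemma matrix_coefficient_Udual:
  assumes "galilei_module w A"
  shows "lf (\<lambda>xs. fold A xs q l) \<in> Udual w"
proof -
  let ?f = "lf (\<lambda>xs. fold A xs q l)"
  have lin: "linear_action A" using assms by (simp add: galilei_module_def)
  have rel: "?f (wd a * r * wd b) = 0" if "r \<in> relators w" for a b r
  proof -
    let ?p = "fold A a q"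
    note [simp] = mult_single plus_word_def algebra_simps generators_eq_wd one_eq_wd
    consider "r = Kq * Kinvq - 1" | "r = Kinvq * Kq - 1"
      | X where "r = Mq * X - X * Mq" "X \<in> {Kq, Kinvq, Bq, Tq}"
      | "r = Kq * Tq - Tq * Kq" | "r = Kq * Bq * Kinvq - (Bq - smul (\<i> * of_real w) Mq)"
      | "r = (Bq * Tq - Tq * Bq) - smul (\<i> / (2 * of_real w)) (Kq - Kinvq)"
      using \<open>r \<in> relators w\<close> unfolding relators_def by blast
    then show ?thesis
    proof cases
      case 1
      show ?thesis unfolding 1 using assms by (simp add: galilei_module_def)
    next
      case 2
      show ?thesis unfolding 2 using assms by (simp add: galilei_module_def)
    next
      case (3 X)
      show ?thesis unfolding 3(1) using 3(2) assms by (auto simp: galilei_module_def)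
    next
      case 4
      show ?thesis unfolding 4 using assms by (simp add: galilei_module_def)
    next
      case 5
      have "fold A b (A GenKinv (A GenB (A GenK ?p))) l =
        fold A b (A GenB ?p) l - \<i> * of_real w * fold A b (A GenM ?p) l"
        using assms lin by (simp only: galilei_module_def fold_action_diff fold_action_mult)
      then show ?thesis unfolding 5 by simp
    next
      case 6
      have "fold A b (A GenT (A GenB ?p)) l - fold A b (A GenB (A GenT ?p)) l =
        \<i> / (2 * of_real w) * (fold A b (A GenK ?p) l - fold A b (A GenKinv ?p) l)"
        using assms lin
        by (simp only: galilei_module_def fold_action_diff[symmetric] fold_action_mult[symmetric])
      then show ?thesis unfolding 6 by (simp add: smul_diff)
    qed
  qed
  \<comment> \<open>Arbitrary factors on both sides make the claim stable under the ideal
    operations, since further multiplications are absorbed into \<open>Y\<close> or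
    \<open>Z\<close>.\<close>
  have "?f (Y * X * Z) = 0" if "X \<in> galilei_ideal w" for X Y Z
    using that
  proof (induction arbitrary: Y Z rule: galilei_ideal_induct)
    case (relator r)
    have "?f (wd a * r * Z) = 0" for a
      by (induction Z rule: falg_induct)
        (use rel[OF relator] in \<open>auto simp: distrib_left smul_mult_right\<close>)
    then show ?case
      by (induction Y rule: falg_induct) (auto simp: distrib_right smul_mult_left)
  next
    case (left X Y')
    show ?case using left[of "Y * Y'" Z] by (simp add: mult.assoc)
  next
    case (right X Y')
    show ?case using right[of Y "Y' * Z"] by (simp add: mult.assoc)
  qed (simp_all add: distrib_left distrib_right)
  from this[of _ 1 1] show ?thesis by (simp add: Udual_def linear_lf)
qed

section \<open>The modules behind \<open>phi\<close>, \<open>chi\<close> and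
  \<open>v\<close>\<close>

fun galilei_action :: "real \<Rightarrow> real \<Rightarrow> real \<Rightarrow> complex \<Rightarrow> gen_action" where
  "galilei_action w m u s GenK q l = q (l + 1)"
| "galilei_action w m u s GenKinv q l = q (l - 1)"
| "galilei_action w m u s GenB q l = \<i> * of_real (w * m) * (of_int l + s) * q l"
| "galilei_action w m u s GenM q l = of_real m * q l"
| "galilei_action w m u s GenT q l =
    of_real u * q l + of_real (1 / (2 * w\<^sup>2 * m)) * (q (l + 1) + q (l - 1) - 2 * q l)"

text \<open>
  On functionals that factor through the quotient \<open>K = 1\<close>, \<open>M = T = 0\<close>, the next two actions describe \<open>B\<close>
  in terms of the families \<open>\<chi>\<^sup>l\<close> and \<open>v\<^sup>l\<close>.
\<close>

fun chi_action :: "real \<Rightarrow> real \<Rightarrow> gen_action" where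
  "chi_action w m GenK q l = q l"
| "chi_action w m GenKinv q l = q l"
| "chi_action w m GenB q l = \<i> * of_real (w * m) * of_int l * q (l + 1)"
| "chi_action w m GenM q l = 0"
| "chi_action w m GenT q l = 0"

fun v_action :: gen_action where
  "v_action GenK q l = q l"
| "v_action GenKinv q l = q l"
| "v_action GenB q l = \<i> * of_int l * q (l - 1)"
| "v_action GenM q l = 0"
| "v_action GenT q l = 0"

lemma linear_galilei_action: "linear_action (galilei_action w m u s)"
proof -
  define t :: complex where "t = of_real (1 / (2 * w\<^sup>2 * m))"
  note [simp] = t_def[symmetric] and [simp del] = of_real_divide of_real_mult
  have "galilei_action w m u s g (\<lambda>l. q l + r l) l = galilei_action w m u s g q l + galilei_action w m u s g r l"
    "galilei_action w m u s g (\<lambda>l. c * q l) l = c * galilei_action w m u s g q l" for g c q r l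
    by (cases g; simp add: algebra_simps)+
  then show ?thesis unfolding linear_action_def by blast
qed

lemma linear_chi_action: "linear_action (chi_action w m)"
proof -
  have "chi_action w m g (\<lambda>l. q l + r l) = (\<lambda>l. chi_action w m g q l + chi_action w m g r l)"
    "chi_action w m g (\<lambda>l. c * q l) = (\<lambda>l. c * chi_action w m g q l)" for g c q r
    by (cases g; simp add: fun_eq_iff algebra_simps)+
  then show ?thesis by (simp add: linear_action_def)
qed

lemma linear_v_action: "linear_action v_action"
proof -
  have "v_action g (\<lambda>l. q l + r l) = (\<lambda>l. v_action g q l + v_action g r l)"
    "v_action g (\<lambda>l. c * q l) = (\<lambda>l. c * v_action g q l)" for g c q r
    by (cases g; simp add: fun_eq_iff algebra_simps)+
  then show ?thesis by (simp add: linear_action_def)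
qed

lemma galilei_module_galilei_action:
  assumes "w \<noteq> 0" "m \<noteq> 0"
  shows "galilei_module w (galilei_action w m u s)"
proof -
  let ?A = "galilei_action w m u s"
  have inverse: "?A GenKinv (?A GenK q) = q" "?A GenK (?A GenKinv q) = q" and T: "?A GenT (?A GenK q) = ?A GenK (?A GenT q)" for q
    by (simp_all add: fun_eq_iff)
  have M: "?A g (?A GenM q) = ?A GenM (?A g q)" for g q
    by (cases g) (simp_all add: fun_eq_iff algebra_simps)
  have B: "?A GenKinv (?A GenB (?A GenK q)) = (\<lambda>l. ?A GenB q l - \<i> * of_real w * ?A GenM q l)" for q
    by (simp add: fun_eq_iff algebra_simps)
  have BT: "?A GenT (?A GenB q) l - ?A GenB (?A GenT q) l =
    \<i> / (2 * of_real w) * (?A GenK q l - ?A GenKinv q l)" for q l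
  proof -
    define t :: complex where "t = of_real (1 / (2 * w\<^sup>2 * m))"
    define h where "h = \<i> * of_real (w * m)"
    have "?A GenT (?A GenB q) l - ?A GenB (?A GenT q) l = t * h * (?A GenK q l - ?A GenKinv q l)"
      unfolding galilei_action.simps t_def[symmetric] h_def[symmetric] by (simp add: algebra_simps)
    also have "t * h = \<i> / (2 * of_real w)"
      using assms by (simp add: t_def h_def field_simps power2_eq_square)
    finally show ?thesis .
  qed
  show ?thesis
    unfolding galilei_module_def
    by (intro conjI allI) (rule linear_galilei_action inverse M T B ext[OF BT])+
qed

lemma galilei_module_chi_action: "galilei_module w (chi_action w m)"
proof -
  have "chi_action w m g (chi_action w m GenM q) = chi_action w m GenM (chi_action w m g q)" for g q
    by (cases g) (simp_all add: fun_eq_iff)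
  then show ?thesis
    by (simp add: galilei_module_def linear_chi_action fun_eq_iff)
qed

lemma galilei_module_v_action: "galilei_module w v_action"
proof -
  have "v_action g (v_action GenM q) = v_action GenM (v_action g q)" for g q
    by (cases g) (simp_all add: fun_eq_iff)
  then show ?thesis
    by (simp add: galilei_module_def linear_v_action fun_eq_iff)
qed

definition ecoef :: "real \<Rightarrow> real \<Rightarrow> real \<Rightarrow> int \<Rightarrow> gen list \<Rightarrow> complex" where
  "ecoef w m u l xs = fold (galilei_action w m u 0) xs (\<lambda>_. 1) l"

definition chicoef :: "real \<Rightarrow> real \<Rightarrow> int \<Rightarrow> gen list \<Rightarrow> complex" where
  "chicoef w m l xs = fold (chi_action w m) xs (\<lambda>_. 1) l"

text \<open>The start vector lists the values at the unit element: \<open>v^l\<close> is 1 there for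
  \<open>l = 0\<close> and 0 for larger \<open>l\<close>. The powers of \<open>chi\<close> all take
  the value 1 there, whence the constant start vector of \<open>chicoef\<close>.\<close>

definition vcoef :: "int \<Rightarrow> gen list \<Rightarrow> complex" where
  "vcoef l xs = fold v_action xs (\<lambda>k. if k = 0 then 1 else 0) l"

lemma ecoef_Nil [simp]: "ecoef w m u l [] = 1"
  and ecoef_snoc [simp]:
    "ecoef w m u l (xs @ [g]) = galilei_action w m u 0 g (\<lambda>l. ecoef w m u l xs) l"
  by (simp_all add: ecoef_def fun_eq_iff)

lemma vcoef_Nil [simp]: "vcoef l [] = (if l = 0 then 1 else 0)"
  and vcoef_snoc [simp]: "vcoef l (xs @ [g]) = v_action g (\<lambda>l. vcoef l xs) l"
  by (simp_all add: vcoef_def)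

lemma ecoef_Udual: "w \<noteq> 0 \<Longrightarrow> m \<noteq> 0 \<Longrightarrow> lf (ecoef w m u l) \<in> Udual w"
  using matrix_coefficient_Udual[OF galilei_module_galilei_action] by (simp add: ecoef_def[abs_def])

lemma chicoef_Udual: "lf (chicoef w m l) \<in> Udual w"
  using matrix_coefficient_Udual[OF galilei_module_chi_action] by (simp add: chicoef_def[abs_def])

lemma vcoef_Udual: "lf (vcoef l) \<in> Udual w"
  using matrix_coefficient_Udual[OF galilei_module_v_action] by (simp add: vcoef_def[abs_def])

subsection \<open>Identification of \<open>\<phi>\<close> and \<open>v\<close>\<close>

lemma wd_power: "wd xs ^ n = wd (concat (replicate n xs))"
  by (induction n) (simp_all add: one_eq_wd)

definition Kword :: "int \<Rightarrow> gen list" where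
  "Kword l = (if 0 \<le> l then replicate (nat l) GenK else replicate (nat (- l)) GenKinv)"

lemma concat_replicate_singleton: "concat (replicate n [x]) = replicate n x"
  by (induction n) simp_all

lemma pbw_eq_wd:
  "pbw a l c d = wd (concat (replicate a [GenKinv, GenM]) @ Kword l @ replicate c GenT
    @ concat (replicate d [GenK, GenB]))"
  by (simp add: pbw_def Kpow_def Kword_def generators_eq_wd wd_power concat_replicate_singleton)

lemma concat_replicate_Suc: "concat (replicate (Suc n) xs) = concat (replicate n xs) @ xs"
  by (induction n) simp_all

text \<open>Constants are eigenvectors of \<open>I\<close>, \<open>K\<close> and \<open>T\<close>
  with eigenvalues \<open>m\<close>, 1 and \<open>u\<close>. If \<open>d > 0\<close>, the word ends
  in \<open>B\<close>, which at \<open>l = 0\<close> and \<open>s = 0\<close> multiplies by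
  0.\<close>

lemma ecoef_pbw:
  "lf (ecoef w m u 0) (pbw a l c d) = (if d = 0 then of_real (m ^ a * u ^ c) else 0)"
proof -
  let ?A = "galilei_action w m u 0"
  have I: "fold ?A (concat (replicate a [GenKinv, GenM])) (\<lambda>_. x) = (\<lambda>_. of_real (m ^ a) * x)" for x
  proof (induction a arbitrary: x)
    case (Suc a)
    have "?A GenM (?A GenKinv (\<lambda>_. x)) = (\<lambda>_. of_real m * x)" by (simp add: fun_eq_iff)
    then show ?case by (simp add: Suc ac_simps)
  qed simp
  have K: "fold ?A (Kword l) (\<lambda>_. x) = (\<lambda>_. x)" for x
  proof -
    have "fold ?A (replicate n g) (\<lambda>_. x) = (\<lambda>_. x)" if "g \<in> {GenK, GenKinv}" for n g
    proof (induction n)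
      case (Suc n)
      have "?A g (\<lambda>_. x) = (\<lambda>_. x)" using that by auto
      then show ?case using Suc by simp
    qed simp
    then show ?thesis by (simp add: Kword_def)
  qed
  have T: "fold ?A (replicate c GenT) (\<lambda>_. x) = (\<lambda>_. of_real (u ^ c) * x)" for x
  proof (induction c arbitrary: x)
    case (Suc c)
    have "?A GenT (\<lambda>_. x) = (\<lambda>_. of_real u * x)" by (simp add: fun_eq_iff)
    then show ?case using Suc by (simp add: ac_simps)
  qed simp
  have N: "fold ?A (concat (replicate d [GenK, GenB])) (\<lambda>_. x) 0 = (if d = 0 then x else 0)" for x
  proof (cases d)
    case (Suc n)
    show ?thesis unfolding Suc concat_replicate_Suc by simp
  qed simp
  show ?thesis
    unfolding pbw_eq_wd lf_wd ecoef_def fold_append comp_apply I K T N by simp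
qed

lemma vcoef_pbw:
  "lf (vcoef 1) (pbw a l c d) = (if a = 0 \<and> c = 0 \<and> d = 1 then \<i> else 0)"
proof -
  let ?A = "v_action" and ?\<delta> = "\<lambda>k :: int. if k = 0 then 1 else 0 :: complex"
  have zero: "fold ?A xs (\<lambda>_. 0) l = 0" for xs l
    by (rule fold_action_zero[OF linear_v_action])
  have I: "fold ?A (concat (replicate a [GenKinv, GenM])) q = (if a = 0 then q else (\<lambda>_. 0))" for q
  proof (cases a)
    case (Suc n)
    have "?A GenM q = (\<lambda>_. 0)" for q by (simp add: fun_eq_iff)
    then show ?thesis using zero by (auto simp: Suc simp del: fold_replicate)
  qed simp
  have K: "fold ?A (Kword l) q = q" for q
  proof -
    have "fold ?A (replicate n g) q = q" if "g \<in> {GenK, GenKinv}" for n g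
    proof (induction n)
      case (Suc n)
      have "?A g q = q" using that by auto
      then show ?case using Suc by simp
    qed simp
    then show ?thesis by (simp add: Kword_def)
  qed
  have T: "fold ?A (replicate c GenT) q = (if c = 0 then q else (\<lambda>_. 0))" for q
  proof (cases c)
    case (Suc n)
    have "?A GenT q = (\<lambda>_. 0)" for q by (simp add: fun_eq_iff)
    then show ?thesis using zero by (auto simp: Suc simp del: fold_replicate)
  qed simp
  \<comment> \<open>Lowering stops at index 0, where the factor \<open>l\<close> in the action of
    \<open>B\<close> vanishes; a second \<open>N\<close> therefore annihilates
    \<open>v\<close>.\<close>
  have N0: "fold ?A (concat (replicate d [GenK, GenB])) ?\<delta> 0 = (if d = 0 then 1 else 0)" for d
  proof (cases d)
    case (Suc n)
    show ?thesis unfolding Suc concat_replicate_Suc by simp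
  qed simp
  have N: "fold ?A (concat (replicate d [GenK, GenB])) ?\<delta> 1 = (if d = 1 then \<i> else 0)"
  proof (cases d)
    case (Suc n)
    show ?thesis unfolding Suc concat_replicate_Suc by (simp add: N0)
  qed simp
  let ?N = "concat (replicate d [GenK, GenB])"
  have "lf (vcoef 1) (pbw a l c d) = fold ?A ?N (fold ?A (replicate c GenT) (fold ?A (Kword l)
      (fold ?A (concat (replicate a [GenKinv, GenM])) ?\<delta>))) 1"
    by (simp only: pbw_eq_wd lf_wd vcoef_def fold_append comp_apply)
  also have "\<dots> = fold ?A ?N (if a = 0 \<and> c = 0 then ?\<delta> else (\<lambda>_. 0)) 1"
    unfolding K I T by (cases "a = 0"; cases "c = 0") simp_all
  also have "\<dots> = (if a = 0 \<and> c = 0 then fold ?A ?N ?\<delta> 1 else 0)"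
    using zero by presburger
  also have "\<dots> = (if a = 0 \<and> c = 0 \<and> d = 1 then \<i> else 0)"
    unfolding N by presburger
  finally show ?thesis .
qed

lemma vq_eq: "vq w = lf (vcoef 1)"
  unfolding vq_def
proof (rule the_equality)
  show "lf (vcoef 1) \<in> Udual w \<and>
    (\<forall>a l c d. lf (vcoef 1) (pbw a l c d) = (if a = 0 \<and> c = 0 \<and> d = 1 then \<i> else 0))"
    using vcoef_Udual vcoef_pbw by blast
  fix f
  assume f: "f \<in> Udual w \<and> (\<forall>a l c d. f (pbw a l c d) = (if a = 0 \<and> c = 0 \<and> d = 1 then \<i> else 0))"
  show "f = lf (vcoef 1)"
  proof (rule Udual_eqI)
    show "f (pbw a l c d) = lf (vcoef 1) (pbw a l c d)" for a l c d
      unfolding vcoef_pbw using f by blast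
  qed (use f in blast, rule vcoef_Udual)
qed

lemma phi_eq:
  assumes "w \<noteq> 0" "m \<noteq> 0"
  shows "phi w m u = lf (ecoef w m u 0)"
  unfolding phi_def
proof (rule the_equality)
  show "lf (ecoef w m u 0) \<in> Udual w \<and>
    (\<forall>a l c d. lf (ecoef w m u 0) (pbw a l c d) = (if d = 0 then of_real (m ^ a * u ^ c) else 0))"
    using ecoef_Udual[OF assms] ecoef_pbw by blast
  fix f
  assume f: "f \<in> Udual w \<and> (\<forall>a l c d. f (pbw a l c d) = (if d = 0 then of_real (m ^ a * u ^ c) else 0))"
  show "f = lf (ecoef w m u 0)"
  proof (rule Udual_eqI)
    show "f (pbw a l c d) = lf (ecoef w m u 0) (pbw a l c d)" for a l c d
      unfolding ecoef_pbw using f by blast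
  qed (use f in blast, rule ecoef_Udual[OF assms])
qed

section \<open>The powers of \<open>\<chi>\<close> and the basis of the induced representation space\<close>

text \<open>
  Functions of the difference \<open>j - i\<close> are stable under the tensor product of the actions for
  \<open>(-m, -u)\<close> and \<open>(m, u)\<close>. Everything about \<open>\<phi>\<^sup>-\<^sup>1\<close>, \<open>\<phi>\<^sup>*\<close> and the powers of \<open>\<chi>\<close> follows from this.
\<close>

lemma csum_ecoef_ecoef:
  "csum xs (\<lambda>a b. fold (galilei_action w (- m) (- u) 0) a
      (\<lambda>i. fold (galilei_action w m u 0) b (\<lambda>j. q (j - i)) j\<^sub>0) i\<^sub>0) =
    fold (chi_action w m) xs q (j\<^sub>0 - i\<^sub>0)"
proof (induction xs arbitrary: q)
  case (Cons g xs)
  let ?R = "galilei_action w m u 0" and ?R' = "galilei_action w (- m) (- u) 0"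
  note linear = linear_galilei_action[of w m u 0] linear_galilei_action[of w "- m" "- u" 0]
  define t :: complex where "t = of_real (1 / (2 * w\<^sup>2 * m))"
  define h where "h = \<i> * of_real (w * m)"
  define F where "F a Q = fold ?R' a Q i\<^sub>0" for a Q
  define G where "G b q = fold ?R b q j\<^sub>0" for b q
  have t': "complex_of_real (1 / (2 * w\<^sup>2 * - m)) = - t" by (simp add: t_def)
  have h': "\<i> * of_real (w * - m) = - h" by (simp add: h_def)
  have R: "?R GenK q = (\<lambda>j. q (j + 1))" "?R GenKinv q = (\<lambda>j. q (j - 1))"
    "?R GenB q = (\<lambda>j. h * of_int j * q j)" "?R GenM q = (\<lambda>j. of_real m * q j)"
    "?R GenT q = (\<lambda>j. of_real u * q j + t * (q (j + 1) + q (j - 1) - 2 * q j))" for q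
    by (simp_all add: fun_eq_iff t_def h_def)
  have R': "?R' GenK q = (\<lambda>j. q (j + 1))" "?R' GenKinv q = (\<lambda>j. q (j - 1))"
    "?R' GenB q = (\<lambda>j. - h * of_int j * q j)" "?R' GenM q = (\<lambda>j. - of_real m * q j)"
    "?R' GenT q = (\<lambda>j. - of_real u * q j + (- t) * (q (j + 1) + q (j - 1) - 2 * q j))" for q
    by (simp_all only: fun_eq_iff galilei_action.simps t' h' of_real_minus add_0_right) simp_all
  have F: "F a Q + F a Q' = F a (\<lambda>i. Q i + Q' i)" "c * F a Q = F a (\<lambda>i. c * Q i)" for a Q Q' c
    by (simp_all add: F_def fold_action_add fold_action_mult linear)
  have G: "G a Q + G a Q' = G a (\<lambda>i. Q i + Q' i)" "c * G a Q = G a (\<lambda>i. c * Q i)"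
    "G a Q - G a Q' = G a (\<lambda>i. Q i - Q' i)" for a Q Q' c
    by (simp_all add: G_def fold_action_add fold_action_mult fold_action_diff linear)
  have IH: "csum xs (\<lambda>a b. F a (\<lambda>i. G b (\<lambda>j. chi_action w m g q (j - i)))) =
    fold (chi_action w m) xs (chi_action w m g q) (j\<^sub>0 - i\<^sub>0)"
    unfolding F_def G_def by (rule Cons)
  have "csum (g # xs) (\<lambda>a b. F a (\<lambda>i. G b (\<lambda>j. q (j - i)))) =
    csum xs (\<lambda>a b. F a (\<lambda>i. G b (\<lambda>j. chi_action w m g q (j - i))))"
  proof (cases g)
    case GenK
    show ?thesis by (simp add: GenK F_def G_def R R')
  next
    case GenKinv
    show ?thesis by (simp add: GenKinv F_def G_def R R')
  next
    case GenB
    have F': "F (x # a) Q = F a (?R' x Q)" and G': "G (x # a) p = G a (?R x p)" for x a Q p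
      by (simp_all add: F_def G_def)
    \<comment> \<open>The summands come from \<open>B (x) K\<close> and \<open>K^-1 (x) B\<close>.
      Raising \<open>j\<close> and lowering \<open>i\<close> change \<open>j - i\<close> alike, and
      the multipliers \<open>-h i\<close> and \<open>h j\<close> add up to \<open>h (j - i)\<close>,
      the factor of \<open>B\<close> on \<open>chi^(j-i)\<close>.\<close>
    have "csum (g # xs) (\<lambda>a b. F a (\<lambda>i. G b (\<lambda>j. q (j - i)))) =
      csum xs (\<lambda>a b. F a (\<lambda>i. G b (\<lambda>j. - h * of_int i * q (j + 1 - i) + h * of_int j * q (j - (i - 1)))))"
      by (simp only: GenB csum.simps cgen.simps append_Cons append_Nil F' G' R R' csum_add[symmetric] F G)
    then show ?thesis by (simp add: GenB algebra_simps h_def)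
  next
    case GenM
    have F': "F (x # a) Q = F a (?R' x Q)" and G': "G (x # a) p = G a (?R x p)" for x a Q p
      by (simp_all add: F_def G_def)
    have "csum (g # xs) (\<lambda>a b. F a (\<lambda>i. G b (\<lambda>j. q (j - i)))) =
      csum xs (\<lambda>a b. F a (\<lambda>i. G b (\<lambda>j. - of_real m * q (j + 1 - i) + of_real m * q (j - (i - 1)))))"
      by (simp only: GenM csum.simps cgen.simps append_Cons append_Nil F' G' R R' csum_add[symmetric] F G)
    then show ?thesis by (simp add: GenM algebra_simps)
  next
    case GenT
    have F': "F (x # a) Q = F a (?R' x Q)" and G': "G (x # a) p = G a (?R x p)" for x a Q p
      by (simp_all add: F_def G_def)
    \<comment> \<open>The second difference does not see the direction of the shift, so it is the
      same in \<open>i\<close> and in \<open>j\<close>; the opposite signs of \<open>t\<close> and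
      \<open>u\<close> cancel everything.\<close>
    have "csum (g # xs) (\<lambda>a b. F a (\<lambda>i. G b (\<lambda>j. q (j - i)))) =
      csum xs (\<lambda>a b. F a (\<lambda>i. G b (\<lambda>j. - of_real u * q (j - i) +
          - t * (q (j - (i + 1)) + q (j - (i - 1)) - 2 * q (j - i)) +
        (of_real u * q (j - i) + t * (q (j + 1 - i) + q (j - 1 - i) - 2 * q (j - i))))))"
      by (simp only: GenT csum.simps cgen.simps append_Cons append_Nil F' G' R R' csum_add[symmetric] F G)
    then show ?thesis by (simp add: GenT algebra_simps)
  qed
  then show ?case using IH by (simp only: F_def G_def fold_simps)
qed simp

lemma conv_ecoef_neg_ecoef:
  "lf (ecoef w (- m) (- u) i) \<star> lf (ecoef w m u j) = lf (chicoef w m (j - i))"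
proof -
  have "fold (galilei_action w (- m) (- u) 0) a (\<lambda>i. fold (galilei_action w m u 0) b (\<lambda>j. 1) j) i =
    ecoef w (- m) (- u) i a * ecoef w m u j b" for a b
    using fold_action_mult[OF linear_galilei_action, of w "-m" "-u" 0 a "ecoef w m u j b" "\<lambda>_. 1" i]
    by (simp add: ecoef_def mult.commute)
  then show ?thesis
    using csum_ecoef_ecoef[of _ w m u "\<lambda>_. 1" j i] by (simp add: conv_lf chicoef_def[abs_def])
qed

lemma chicoef_zero: "lf (chicoef w m 0) = counit"
proof -
  have "fold (chi_action w m) xs q 0 = counit_word xs * q 0" for xs q
  proof (induction xs arbitrary: q)
    case (Cons g xs)
    then show ?case by (cases g) simp_all
  qed simp
  then show ?thesis by (simp add: chicoef_def[abs_def] counit_eq_lf)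
qed

lemma conv_ecoef_ecoef_neg: "lf (ecoef w m u j) \<star> lf (ecoef w (- m) (- u) j) = counit"
  using conv_ecoef_neg_ecoef[of w "- m" "- u" j j] by (simp add: chicoef_zero)

text \<open>As \<open>E'_i E_n\<close> depends on \<open>n - i\<close> only, \<open>chi^k\<close>
  may be written as \<open>E'_j E_(j+k)\<close> with the \<open>j\<close> of the left factor; then
  \<open>E_j E'_j\<close> cancels.\<close>

lemma conv_ecoef_chicoef: "lf (ecoef w m u j) \<star> lf (chicoef w m k) = lf (ecoef w m u (j + k))"
proof -
  have "lf (chicoef w m k) = lf (ecoef w (- m) (- u) j) \<star> lf (ecoef w m u (j + k))"
    using conv_ecoef_neg_ecoef[of w m u j "j + k"] by simp
  then show ?thesis
    by (simp add: conv_assoc[symmetric] conv_ecoef_ecoef_neg conv_counit_left)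
qed

text \<open>\<open>chi^j\<close> is \<open>E'_0 E_j\<close>, and multiplying by \<open>chi^k\<close>
  on the right shifts \<open>E_j\<close> to \<open>E_(j+k)\<close>. The parameter \<open>u\<close>
  is absent from \<open>chicoef\<close>, so it is set to 0.\<close>

lemma conv_chicoef_chicoef: "lf (chicoef w m j) \<star> lf (chicoef w m k) = lf (chicoef w m (j + k))"
  using conv_ecoef_neg_ecoef[of w m 0 0] conv_ecoef_chicoef[of w m 0 j k]
  by (metis conv_assoc diff_zero)

lemma vcoef_zero: "vcoef 0 xs = counit_word xs"
proof (induction xs rule: rev_induct)
  case (snoc g xs)
  then show ?case by (cases g) simp_all
qed simp

text \<open>At \<open>l = 0\<close>, multiplication by the inverse of \<open>phi\<close> on the left
  turns this into \<open>wm v1 = chi - 1\<close>. General \<open>l\<close> is required by the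
  induction, since letters move the index.\<close>

lemma conv_vcoef_ecoef:
  assumes "w \<noteq> 0" "m \<noteq> 0"
  shows "lf (vcoef 1) \<star> lf (ecoef w m u l) =
    fscale (1 / of_real (w * m)) (lf (ecoef w m u (l + 1)) - lf (ecoef w m u l))"
proof -
  have "of_real (w * m) * csum xs (\<lambda>a b. vcoef 1 a * ecoef w m u l b) = ecoef w m u (l + 1) xs - ecoef w m u l xs" for xs l
  proof (induction xs arbitrary: l rule: rev_induct)
    case (snoc g xs)
    define t :: complex where "t = of_real (1 / (2 * w\<^sup>2 * m))"
    define z where "z = complex_of_real (w * m)"
    define S where "S l = csum xs (\<lambda>a b. vcoef 1 a * ecoef w m u l b)" for l
    have IH: "z * S l = ecoef w m u (l + 1) xs - ecoef w m u l xs" for l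
      using snoc by (simp add: S_def z_def)
    have S_mult: "csum xs (\<lambda>a b. vcoef 1 a * (c * ecoef w m u l b)) = c * S l" for c l
      by (simp add: S_def csum_mult[symmetric] algebra_simps)
    have S_T: "csum xs (\<lambda>a b. vcoef 1 a * (of_real u * ecoef w m u l b +
        t * (ecoef w m u (l + 1) b + ecoef w m u (l - 1) b - 2 * ecoef w m u l b))) =
      of_real u * S l + t * (S (l + 1) + S (l - 1) - 2 * S l)"
      by (simp add: S_def csum_mult[symmetric] csum_add[symmetric] csum_diff[symmetric] algebra_simps)
    have S_B: "csum xs (\<lambda>a b. \<i> * counit_word a * ecoef w m u l b) = \<i> * ecoef w m u l xs" for l
      using csum_counit_left[of xs "ecoef w m u l"] by (simp add: csum_mult mult.assoc)
    have "z * csum (xs @ [g]) (\<lambda>a b. vcoef 1 a * ecoef w m u l b) =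
      ecoef w m u (l + 1) (xs @ [g]) - ecoef w m u l (xs @ [g])"
    proof (cases g)
      case GenK
      show ?thesis using IH[of "l + 1"] by (simp add: GenK csum_snoc S_def)
    next
      case GenKinv
      show ?thesis using IH[of "l - 1"] by (simp add: GenKinv csum_snoc S_def)
    next
      case GenB
      \<comment> \<open>\<open>B (x) K\<close> lowers \<open>v\<close> to the unit, up to the factor
        i, and raises \<open>E_l\<close> to \<open>E_(l+1)\<close>; \<open>K^-1 (x) B\<close> fixes
        \<open>v\<close> and multiplies \<open>E_l\<close> by its eigenvalue.\<close>
      have "csum (xs @ [g]) (\<lambda>a b. vcoef 1 a * ecoef w m u l b) =
        \<i> * ecoef w m u (l + 1) xs + \<i> * z * of_int l * S l"
        using S_B[of "l + 1"] S_mult[of "\<i> * z * of_int l" l]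
        by (simp add: GenB csum_snoc vcoef_zero z_def[symmetric] del: of_real_mult)
      then have "z * csum (xs @ [g]) (\<lambda>a b. vcoef 1 a * ecoef w m u l b) =
        z * \<i> * ecoef w m u (l + 1) xs + \<i> * z * of_int l * (z * S l)"
        by (simp add: algebra_simps)
      moreover have "ecoef w m u l (xs @ [GenB]) = \<i> * z * of_int l * ecoef w m u l xs" for l
        by (simp add: z_def)
      ultimately show ?thesis by (simp add: GenB IH algebra_simps del: ecoef_snoc)
    next
      case GenM
      have "csum (xs @ [g]) (\<lambda>a b. vcoef 1 a * ecoef w m u l b) = of_real m * S l"
        using S_mult[of "of_real m" l] by (simp add: GenM csum_snoc)
      then have "z * csum (xs @ [g]) (\<lambda>a b. vcoef 1 a * ecoef w m u l b) = of_real m * (z * S l)"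
        by (simp add: algebra_simps)
      then show ?thesis by (simp add: GenM IH algebra_simps)
    next
      case GenT
      have E: "csum (xs @ [g]) (\<lambda>a b. vcoef 1 a * ecoef w m u l b) =
          of_real u * S l + t * (S (l + 1) + S (l - 1) - 2 * S l)"
        using S_T by (simp add: GenT csum_snoc t_def[symmetric] del: of_real_divide)
      have C: "z * csum (xs @ [g]) (\<lambda>a b. vcoef 1 a * ecoef w m u l b) =
          of_real u * (z * S l) + t * (z * S (l + 1) + z * S (l - 1) - 2 * (z * S l))"
        unfolding E by (simp add: algebra_simps)
      have D: "ecoef w m u l (xs @ [GenT]) = of_real u * ecoef w m u l xs +
        t * (ecoef w m u (l + 1) xs + ecoef w m u (l - 1) xs - 2 * ecoef w m u l xs)" for l
        by (simp add: t_def)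
      show ?thesis unfolding GenT D C[unfolded GenT IH] by (simp add: algebra_simps)
    qed
    then show ?case by (simp add: z_def)
  qed simp
  moreover have "complex_of_real (w * m) \<noteq> 0" using assms by simp
  ultimately have "(\<lambda>xs. csum xs (\<lambda>a b. vcoef 1 a * ecoef w m u l b)) =
    (\<lambda>xs. 1 / of_real (w * m) * (ecoef w m u (l + 1) xs - ecoef w m u l xs))"
    by (simp add: fun_eq_iff eq_divide_eq mult.commute del: of_real_mult)
  then show ?thesis by (simp add: conv_lf lf_minus fscale_lf)
qed

text \<open>Equivalently \<open>chi^-1 = 1 - wm v\<close>. \<open>B\<close> sends \<open>v\<close>
  to i and \<open>chi^-1\<close> to -iwm, and both sides vanish at the unit.\<close>

lemma vcoef_eq_chicoef:
  assumes "w \<noteq> 0" "m \<noteq> 0"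
  shows "lf (vcoef 1) = fscale (1 / of_real (w * m)) (counit - lf (chicoef w m (- 1)))"
proof -
  have chi0: "chicoef w m 0 xs = counit_word xs" for xs
    using fun_cong[OF chicoef_zero[of w m], of "wd xs"] by (simp add: counit_eq_lf)
  have "of_real (w * m) * vcoef 1 xs = counit_word xs - chicoef w m (- 1) xs" for xs
  proof (induction xs rule: rev_induct)
    case (snoc g xs)
    then show ?case
      by (cases g) (simp_all add: chicoef_def vcoef_zero chi0[unfolded chicoef_def])
  qed (simp add: chicoef_def)
  moreover have "complex_of_real (w * m) \<noteq> 0" using assms by simp
  ultimately have "vcoef 1 = (\<lambda>xs. 1 / of_real (w * m) * (counit_word xs - chicoef w m (- 1) xs))"
    by (simp add: fun_eq_iff eq_divide_eq mult.commute del: of_real_mult)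
  then show ?thesis by (simp add: counit_eq_lf lf_minus fscale_lf)
qed

lemma conv_counit_Udual: "f \<in> Udual w \<Longrightarrow> counit \<star> f = f" "f \<in> Udual w \<Longrightarrow> f \<star> counit = f"
  using linear_eq_lf[of f] conv_counit_left conv_counit_right by (auto simp: Udual_def) metis+

lemma inv_dual_alg:
  assumes "f \<in> Udual w" "g \<in> Udual w" "f \<star> g = counit" "g \<star> f = counit"
  shows "inv\<^bsub>dual_alg w\<^esub> f = g"
  unfolding m_inv_def
proof (rule the_equality)
  fix y
  assume "y \<in> carrier (dual_alg w) \<and> f \<otimes>\<^bsub>dual_alg w\<^esub> y = \<one>\<^bsub>dual_alg w\<^esub> \<and> y \<otimes>\<^bsub>dual_alg w\<^esub> f = \<one>\<^bsub>dual_alg w\<^esub>"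
  then have y: "y \<in> Udual w" "y \<star> f = counit" by (simp_all add: dual_alg_def)
  have "y = y \<star> (f \<star> g)" using assms(3) by (simp only: conv_counit_Udual(2)[OF y(1)])
  also have "\<dots> = g" using y by (simp only: conv_assoc[symmetric] conv_counit_Udual(1)[OF assms(2)])
  finally show "y = g" .
qed (use assms in \<open>simp add: dual_alg_def\<close>)

lemma conv_zero_right: "h \<star> 0 = 0"
  using conv_diff_right[of h 0 0] by simp

lemma fscale_fscale [simp]: "fscale c (fscale d f) = fscale (c * d) f"
  by (simp add: fscale_def fun_eq_iff mult.assoc)

lemma fscale_one [simp]: "fscale 1 f = f"
  by (simp add: fscale_def)

lemma span_range_induct [consumes 1, case_names base add scale]:
  assumes "f \<in> fun_vs.span (range e)" "\<And>l. P (e l)" "\<And>f g. P f \<Longrightarrow> P g \<Longrightarrow> P (f + g)"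
    "\<And>c f. P f \<Longrightarrow> P (fscale c f)"
  shows "P f"
  using assms(1)
proof (rule fun_vs.span_induct)
  have "P (fscale 0 (e l))" for l by (rule assms(4)[OF assms(2)])
  then have "P 0" by simp
  then show "fun_vs.subspace {f. P f}" using assms(3,4) by (simp add: fun_vs.subspace_def)
qed (use assms(2) in auto)

text \<open>Independence of the range alone would not exclude repeated members; equal members at
  distinct indices are ruled out by the relation with coefficients 1 and -1.\<close>

lemma independent_family:
  fixes e :: "int \<Rightarrow> falg \<Rightarrow> complex"
  assumes "\<And>A c. finite A \<Longrightarrow> (\<Sum>l\<in>A. fscale (c l) (e l)) = 0 \<Longrightarrow> \<forall>l\<in>A. c l = 0"
  shows "inj e" and "fun_vs.independent (range e)"
proof -
  show inj: "inj e"
  proof (rule injI, rule ccontr)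
    fix i j assume "e i = e j" "i \<noteq> j"
    then have "(\<Sum>l\<in>{i, j}. fscale (if l = i then 1 else - 1) (e l)) = 0"
      by (simp add: fscale_def fun_eq_iff)
    from assms[OF _ this] show False by auto
  qed
  show "fun_vs.independent (range e)"
    unfolding fun_vs.independent_explicit_finite_subsets
  proof (intro allI impI ballI)
    fix S c f
    assume S: "S \<subseteq> range e" "finite S" "(\<Sum>v\<in>S. fscale (c v) v) = 0" "f \<in> S"
    define A where "A = e -` S"
    have A: "S = e ` A" "finite A" "inj_on e A"
      using S inj by (auto simp: A_def finite_vimageI intro: inj_on_subset)
    have "(\<Sum>l\<in>A. fscale (c (e l)) (e l)) = 0"
      using S(3) unfolding A(1) by (simp add: sum.reindex[OF A(3)])
    from assms[OF A(2) this] show "c f = 0" using S(4) A(1) by auto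
  qed
qed

text \<open>Vandermonde argument: the equations are combined with the coefficients of a polynomial
  that vanishes at every node other than \<open>z k\<close>.\<close>

lemma sum_eigenvalue_zero:
  fixes z :: "int \<Rightarrow> complex"
  assumes "finite A" "inj z" "\<And>n. (\<Sum>l\<in>A. c l * z l ^ n) = 0" "k \<in> A"
  shows "c k = 0"
proof -
  define p where "p = (\<Prod>l\<in>A - {k}. [:- z l, 1:])"
  have "(\<Sum>l\<in>A. c l * poly p (z l)) = (\<Sum>l\<in>A. \<Sum>i\<le>degree p. coeff p i * (c l * z l ^ i))"
    by (simp add: poly_altdef sum_distrib_left algebra_simps)
  also have "\<dots> = (\<Sum>i\<le>degree p. coeff p i * (\<Sum>l\<in>A. c l * z l ^ i))"
    by (subst sum.swap) (simp add: sum_distrib_left)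
  also have "\<dots> = 0" by (simp add: assms(3))
  finally have "(\<Sum>l\<in>A. c l * poly p (z l)) = 0" .
  moreover have "(\<Sum>l\<in>A. c l * poly p (z l)) = c k * poly p (z k)"
  proof -
    have "poly p (z l) = 0" if "l \<in> A" "l \<noteq> k" for l
      using that assms(1) by (auto simp: p_def poly_prod)
    then show ?thesis
      using assms(1,4) by (simp add: sum.remove[of A k])
  qed
  moreover have "poly p (z k) \<noteq> 0"
    using assms(1,2) by (auto simp: p_def poly_prod inj_eq)
  ultimately show ?thesis by simp
qed

lemma sum_fun_apply: "(\<Sum>l\<in>A. f l) x = (\<Sum>l\<in>A. f l x)"
  by (induction A rule: infinite_finite_induct) auto

section \<open>The algebra \<open>H_0\<close> and the basis of the representation space\<close>

context
  fixes w m u :: real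
  assumes w: "w \<noteq> 0" and m: "m \<noteq> 0"
begin

lemma phi_inverse: "inv\<^bsub>dual_alg w\<^esub> (phi w m u) = lf (ecoef w (- m) (- u) 0)"
  using conv_ecoef_neg_ecoef[of w m u 0 0] w m
  by (simp add: phi_eq inv_dual_alg ecoef_Udual conv_ecoef_ecoef_neg chicoef_zero)

lemma v1_eq: "v1 w m u = fscale (1 / of_real (w * m)) (lf (chicoef w m 1) - counit)"
  using conv_ecoef_neg_ecoef[of w m u 0 0] conv_ecoef_neg_ecoef[of w m u 0 1]
  unfolding v1_def phi_inverse unfolding phi_eq[OF w m] vq_eq conv_assoc conv_vcoef_ecoef[OF w m]
  by (simp add: conv_fscale_right conv_diff_right chicoef_zero)

lemma chi_eq: "chi w m u = lf (chicoef w m 1)"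
proof -
  have "complex_of_real (w * m) * (1 / of_real (w * m)) = 1" using w m by simp
  then show ?thesis unfolding chi_def v1_eq fscale_fscale by simp
qed

lemma chi_nat_power: "chi w m u [^]\<^bsub>dual_alg w\<^esub> n = lf (chicoef w m (int n))"
  by (induction n) (simp_all add: chi_eq dual_alg_def chicoef_zero conv_chicoef_chicoef add.commute)

lemma chipow_eq: "chipow w m u l = lf (chicoef w m l)"
proof (cases "l < 0")
  case True
  then have l: "int (nat (- l)) = - l" by simp
  have "chipow w m u l = inv\<^bsub>dual_alg w\<^esub> (chi w m u [^]\<^bsub>dual_alg w\<^esub> nat (- l))"
    using True by (simp only: chipow_def int_pow_def2 if_True)
  also have "\<dots> = lf (chicoef w m l)"
    unfolding chi_nat_power l
    by (rule inv_dual_alg[OF chicoef_Udual chicoef_Udual]) (simp_all only: conv_chicoef_chicoef add.left_inverse add.right_inverse chicoef_zero)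
  finally show ?thesis .
next
  case False
  then have l: "int (nat l) = l" by simp
  show ?thesis using False by (simp only: chipow_def int_pow_def2 if_False chi_nat_power l)
qed

lemma ebasis_eq: "ebasis w m u l = lf (ecoef w m u l)"
  by (simp add: ebasis_def phi_eq[OF w m] chipow_eq conv_ecoef_chicoef)

lemma conv_ebasis_chipow: "ebasis w m u l \<star> chipow w m u k = ebasis w m u (l + k)"
  by (simp add: ebasis_eq chipow_eq conv_ecoef_chicoef)

lemma conv_chipow_chipow: "chipow w m u j \<star> chipow w m u k = chipow w m u (j + k)"
  by (simp add: chipow_eq conv_chicoef_chicoef)

lemma chipow_zero: "chipow w m u 0 = counit"
  by (simp add: chipow_eq chicoef_zero)

text \<open>From \<open>wm v = 1 - chi^-1\<close> and \<open>wm v1 = chi - 1\<close>, the two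
  generators and the pair \<open>chi\<close>, \<open>chi^-1\<close> express each other. The span of
  the powers is closed under products because exponents add.\<close>

lemma H0_eq: "H0 w m u = fun_vs.span (range (chipow w m u))"
proof (rule equalityI; rule subsetI)
  let ?S = "fun_vs.span (range (chipow w m u))"
  have chi_in: "chipow w m u l \<in> ?S" for l by (rule fun_vs.span_base) simp
  have "f \<star> g \<in> ?S" if "f \<in> ?S" "g \<in> ?S" for f g
    using that(1)
  proof (induction rule: span_range_induct)
    case (base k)
    show ?case using that(2)
      by (induction rule: span_range_induct)
        (simp_all only: conv_chipow_chipow conv_add_right conv_fscale_right chi_in fun_vs.span_add fun_vs.span_scale)
  qed (simp_all only: conv_add_left conv_fscale_left fun_vs.span_add fun_vs.span_scale)
  note mult = this
  have unit: "counit \<in> ?S" using chi_in[of 0] by (simp add: chipow_zero)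
  have incl: "vq w \<in> ?S" "v1 w m u \<in> ?S"
    unfolding vq_eq vcoef_eq_chicoef[OF w m] v1_eq chipow_eq[symmetric] chipow_zero[symmetric]
    by (intro fun_vs.span_scale fun_vs.span_diff chi_in)+
  show "f \<in> ?S" if "f \<in> H0 w m u" for f
    using that unfolding H0_def
  proof (induction rule: subalg.induct)
    case (incl f)
    then show ?case using \<open>vq w \<in> ?S\<close> \<open>v1 w m u \<in> ?S\<close> by auto
  qed (simp_all only: unit mult fun_vs.span_add fun_vs.span_scale)
next
  have diff: "f - g \<in> H0 w m u" if "f \<in> H0 w m u" "g \<in> H0 w m u" for f g
  proof -
    have eq: "f - g = f + fscale (- 1) g" by (simp add: fscale_def fun_eq_iff)
    show ?thesis using that unfolding eq H0_def by (intro subalg.plus subalg.scale)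
  qed
  have chi: "chipow w m u 1 \<in> H0 w m u"
    using chi_def[of w m u] unfolding chipow_eq chi_eq[symmetric] H0_def
    by (simp add: subalg.unit subalg.plus subalg.scale subalg.incl)
  have "chipow w m u (- 1) = counit - fscale (of_real (w * m)) (vq w)"
    using w m unfolding vq_eq vcoef_eq_chicoef[OF w m] chipow_eq by (simp flip: of_real_mult)
  moreover have "counit \<in> H0 w m u" "fscale c (vq w) \<in> H0 w m u" for c
    unfolding H0_def by (simp_all add: subalg.unit subalg.incl subalg.scale)
  ultimately have chi_inv: "chipow w m u (- 1) \<in> H0 w m u" by (simp add: diff)
  have "chipow w m u (int n) \<in> H0 w m u \<and> chipow w m u (- int n) \<in> H0 w m u" for n
  proof (induction n)
    case 0
    then show ?case by (simp add: chipow_zero H0_def subalg.unit)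
  next
    case (Suc n)
    then show ?case
      using chi chi_inv conv_chipow_chipow[of "int n" 1] conv_chipow_chipow[of "- int n" "- 1"]
      unfolding H0_def
      by (metis subalg.mult add.commute minus_add_distrib of_nat_Suc)
  qed
  then have base: "chipow w m u l \<in> H0 w m u" for l
    by (cases l rule: int_cases2) auto
  show "f \<in> H0 w m u" if "f \<in> fun_vs.span (range (chipow w m u))" for f
    using that by (induction rule: span_range_induct)
      (use base in \<open>simp_all only: H0_def subalg.plus subalg.scale\<close>)
qed

lemma Hspace_eq: "Hspace w m u = fun_vs.span (range (ebasis w m u))"
proof -
  interpret module_hom fscale fscale "\<lambda>h. phi w m u \<star> h"
    by unfold_locales (simp_all add: conv_add_right conv_fscale_right)
  have "range (ebasis w m u) = (\<lambda>h. phi w m u \<star> h) ` range (chipow w m u)"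
    by (auto simp: ebasis_def)
  then show ?thesis by (simp add: Hspace_def H0_eq span_image)
qed

lemma ebasis_sum_zero:
  assumes "finite A" "(\<Sum>l\<in>A. fscale (c l) (ebasis w m u l)) = 0"
  shows "\<forall>l\<in>A. c l = 0"
proof
  fix k assume "k \<in> A"
  define z where "z l = \<i> * of_real (w * m) * of_int l" for l
  have E: "ecoef w m u l (replicate n GenB) = z l ^ n" for l n
  proof (induction n)
    case (Suc n)
    have "ecoef w m u l (replicate (Suc n) GenB) = ecoef w m u l (replicate n GenB @ [GenB])"
      by (simp only: replicate_append_same replicate_Suc)
    also have "\<dots> = z l ^ Suc n" by (simp only: ecoef_snoc galilei_action.simps Suc) (simp add: z_def)
    finally show ?case .
  qed simp
  have "(\<Sum>l\<in>A. c l * z l ^ n) = 0" for n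
    using fun_cong[OF assms(2), of "wd (replicate n GenB)"]
    by (simp add: sum_fun_apply fscale_def ebasis_eq E)
  moreover have "inj z" using w m by (auto simp: inj_def z_def)
  ultimately show "c k = 0" using sum_eigenvalue_zero[of A z c k] assms(1) \<open>k \<in> A\<close> by blast
qed

text \<open>Left multiplication by \<open>phi\<close> carries the relation to the \<open>E_l\<close>
  with the same coefficients.\<close>

lemma chipow_sum_zero:
  assumes "finite A" "(\<Sum>l\<in>A. fscale (c l) (chipow w m u l)) = 0"
  shows "\<forall>l\<in>A. c l = 0"
proof -
  have "phi w m u \<star> (\<Sum>l\<in>A. fscale (c l) (chipow w m u l)) = (\<Sum>l\<in>A. fscale (c l) (ebasis w m u l))"
    using assms(1)
    by induction (simp_all only: sum.empty sum.insert conv_zero_right conv_add_right conv_fscale_right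
      ebasis_def not_False_eq_True)
  then have "(\<Sum>l\<in>A. fscale (c l) (ebasis w m u l)) = 0"
    by (simp only: assms(2) conv_zero_right)
  then show ?thesis by (rule ebasis_sum_zero[OF assms(1)])
qed

lemma inj_ebasis: "inj (ebasis w m u)"
  and independent_ebasis: "fun_vs.independent (range (ebasis w m u))"
  by (rule independent_family; rule ebasis_sum_zero; assumption)+

lemma inj_chipow: "inj (chipow w m u)"
  and independent_chipow: "fun_vs.independent (range (chipow w m u))"
  by (rule independent_family; rule chipow_sum_zero; assumption)+

end

section \<open>The modified action\<close>

lemma vq_power: "vq w [^]\<^bsub>dual_alg w\<^esub> n = lf (vcoef (int n))"
proof (induction n)
  case 0
  then show ?case by (simp add: dual_alg_def counit_eq_lf vcoef_zero[abs_def])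
next
  case (Suc n)
  \<comment> \<open>The identity fails at \<open>k = -1\<close>, where the left side is 0 and the
    right side is the counit. In the step for \<open>B\<close> this index arises only with the
    factor \<open>k = 0\<close>.\<close>
  have "csum xs (\<lambda>a b. vcoef k a * vcoef 1 b) = vcoef (k + 1) xs" if "k \<ge> 0" for xs k
    using that
  proof (induction xs arbitrary: k rule: rev_induct)
    case (snoc g xs)
    show ?case
    proof (cases g)
      case GenB
      have "csum xs (\<lambda>a b. \<i> * of_int k * (vcoef (k - 1) a * vcoef 1 b)) = \<i> * of_int k * vcoef k xs"
        using snoc(1)[of "k - 1"] snoc(2) by (cases "k = 0") (simp_all add: csum_mult)
      moreover have "csum xs (\<lambda>a b. vcoef k a * (\<i> * vcoef 0 b)) = \<i> * vcoef k xs"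
        using csum_counit_right[of xs "\<lambda>a. \<i> * vcoef k a"] by (simp add: vcoef_zero ac_simps)
      ultimately show ?thesis
        by (simp add: GenB csum_snoc mult.assoc) (simp add: algebra_simps)
    qed (use snoc in \<open>simp_all add: csum_snoc\<close>)
  qed simp
  then show ?case
    unfolding nat_pow_Suc Suc by (simp add: dual_alg_def vq_eq conv_lf add.commute)
qed

definition Bcount :: "gen list \<Rightarrow> nat" where
  "Bcount xs = length (filter (\<lambda>g. g = GenB) xs)"

definition MT_free :: "gen list \<Rightarrow> bool" where
  "MT_free xs \<longleftrightarrow> GenM \<notin> set xs \<and> GenT \<notin> set xs"

text \<open>Each \<open>B\<close> lowers the power by one like a derivative, \<open>K\<close> acts
  trivially and \<open>M\<close>, \<open>T\<close> by 0, so only the number of \<open>B\<close> in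
  the word matters.\<close>

lemma vcoef_formula:
  "vcoef (int n) xs = (if MT_free xs \<and> Bcount xs = n then \<i> ^ n * fact n else 0)"
proof (induction xs arbitrary: n rule: rev_induct)
  case Nil
  then show ?case by (simp add: MT_free_def Bcount_def)
next
  case (snoc g xs)
  show ?case
  proof (cases g)
    case GenB
    show ?thesis
    proof (cases n)
      case (Suc k)
      have "vcoef (int n - 1) xs = vcoef (int k) xs" by (simp add: Suc)
      then show ?thesis unfolding GenB vcoef_snoc v_action.simps
        by (simp add: Suc snoc MT_free_def Bcount_def algebra_simps)
    qed (simp add: GenB Bcount_def)
  qed (use snoc in \<open>simp_all add: MT_free_def Bcount_def\<close>)
qed

lemma counit_word_formula: "counit_word xs = (if MT_free xs \<and> Bcount xs = 0 then 1 else 0)"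
  using vcoef_formula[of 0 xs] by (simp add: vcoef_zero)

text \<open>Coefficient of the only surviving term of the series on a word: the value
  \<open>i^n n!\<close> of \<open>v^n\<close> cancels the \<open>n!\<close> in the denominator. The
  case \<open>n = 0\<close> is the counit term.\<close>

definition phicoef :: "real \<Rightarrow> real \<Rightarrow> gen list \<Rightarrow> complex" where
  "phicoef w m xs = (if MT_free xs
    then (\<i> * of_real (w * m) / 2) ^ Bcount xs * of_nat (odd_fact (Bcount xs)) else 0)"

lemma phi_bracket_wd:
  "phi_bracket w m u (wd xs) = fscale (phicoef w m xs) (chipow w m u (int (Bcount xs)))"
proof -
  let ?S = "{n. 1 \<le> n \<and> (vq w [^]\<^bsub>dual_alg w\<^esub> n) (wd xs) \<noteq> 0}"
  have S: "?S = (if MT_free xs \<and> Bcount xs \<noteq> 0 then {Bcount xs} else {})"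
    by (auto simp: vq_power vcoef_formula)
  have chi0: "chipow w m u 0 = counit" by (simp add: chipow_def int_pow_def2 dual_alg_def)
  show ?thesis
  proof (cases "MT_free xs \<and> Bcount xs \<noteq> 0")
    case True
    have "complex_of_real ((w * m / 2) ^ n * real (odd_fact n) / fact n) * (\<i> ^ n * fact n) =
      (\<i> * of_real (w * m) / 2) ^ n * of_nat (odd_fact n)" for n
      by (simp add: power_mult_distrib power_divide)
    then show ?thesis unfolding phi_bracket_def S
      using True by (simp add: counit_eq_lf counit_word_formula vq_power vcoef_formula phicoef_def)
  next
    case False
    then show ?thesis unfolding phi_bracket_def S
      by (auto simp add: chi0 phicoef_def counit_word_formula odd_fact_def)
        (simp_all add: counit_eq_lf counit_word_formula)
  qed
qed

text \<open>A further \<open>B\<close> contributes \<open>iwm/2\<close> and, from the double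
  factorial, \<open>2n + 1\<close>. Their product \<open>iwm (n + 1/2)\<close> is the origin of the
  half.\<close>

lemma phicoef_Cons:
  "phicoef w m (GenK # xs) = phicoef w m xs" "phicoef w m (GenKinv # xs) = phicoef w m xs"
  "phicoef w m (GenM # xs) = 0" "phicoef w m (GenT # xs) = 0"
  "phicoef w m (GenB # xs) = \<i> * of_real (w * m) * (of_nat (Bcount xs) + 1 / 2) * phicoef w m xs"
proof -
  have "odd_fact (Suc n) = odd_fact n * (2 * n + 1)" for n by (simp add: odd_fact_def)
  then show "phicoef w m (GenB # xs) = \<i> * of_real (w * m) * (of_nat (Bcount xs) + 1 / 2) * phicoef w m xs"
    by (simp add: phicoef_def Bcount_def MT_free_def field_simps)
qed (simp_all add: phicoef_def Bcount_def MT_free_def)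

lemma Bcount_Cons:
  "Bcount [] = 0" "Bcount (GenK # xs) = Bcount xs" "Bcount (GenKinv # xs) = Bcount xs" "Bcount (GenB # xs) = Suc (Bcount xs)"
  by (simp_all add: Bcount_def)

text \<open>
  Since \<open>\<Sum> (2n - 1)!!/n! x\<^sup>n = (1 - 2x)\<^sup>-\<^sup>1\<^sup>/\<^sup>2\<close>, twisting by \<open>\<phi>[X]\<close> amounts to conjugating the regular action by
  \<open>\<chi>\<^sup>1\<^sup>/\<^sup>2\<close>: the parameter \<open>s\<close> moves from \<open>0\<close> to \<open>1/2\<close>.
\<close>

lemma csum_phicoef:
  "csum xs (\<lambda>c d. phicoef w m d * fold (galilei_action w m u 0) c (\<lambda>j. q (j + int (Bcount d))) l) =
    fold (galilei_action w m u (1 / 2)) xs q l"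
proof (induction xs arbitrary: q)
  case Nil
  then show ?case by (simp add: phicoef_def MT_free_def Bcount_def odd_fact_def)
next
  case (Cons g xs)
  let ?R = "galilei_action w m u 0" and ?R' = "galilei_action w m u (1 / 2)"
  define t :: complex where "t = of_real (1 / (2 * w\<^sup>2 * m))"
  define h where "h = \<i> * of_real (w * m)"
  define F where "F c Q = fold ?R c Q l" for c Q
  have R: "?R GenK q = (\<lambda>j. q (j + 1))" "?R GenKinv q = (\<lambda>j. q (j - 1))"
    "?R GenB q = (\<lambda>j. h * of_int j * q j)" "?R GenM q = (\<lambda>j. of_real m * q j)"
    "?R GenT q = (\<lambda>j. of_real u * q j + t * (q (j + 1) + q (j - 1) - 2 * q j))" for q
    by (simp_all add: fun_eq_iff t_def h_def)
  have R': "?R' GenK q = (\<lambda>j. q (j + 1))" "?R' GenKinv q = (\<lambda>j. q (j - 1))"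
    "?R' GenB q = (\<lambda>j. h * (of_int j + 1 / 2) * q j)" "?R' GenM q = (\<lambda>j. of_real m * q j)"
    "?R' GenT q = (\<lambda>j. of_real u * q j + t * (q (j + 1) + q (j - 1) - 2 * q j))" for q
    by (simp_all add: fun_eq_iff t_def h_def)
  have F: "F a Q + F a Q' = F a (\<lambda>i. Q i + Q' i)" "c * F a Q = F a (\<lambda>i. c * Q i)" for a Q Q' c
    by (simp_all add: F_def fold_action_add fold_action_mult linear_galilei_action)
  have FC: "F (x # a) Q = F a (?R x Q)" for x a Q by (simp add: F_def)
  have "csum (g # xs) (\<lambda>c d. phicoef w m d * F c (\<lambda>j. q (j + int (Bcount d)))) =
    csum xs (\<lambda>c d. phicoef w m d * F c (\<lambda>j. ?R' g q (j + int (Bcount d))))"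
  proof (cases g)
    case GenK
    show ?thesis by (simp add: GenK FC R R' phicoef_Cons Bcount_Cons algebra_simps)
  next
    case GenKinv
    show ?thesis by (simp add: GenKinv FC R R' phicoef_Cons Bcount_Cons algebra_simps)
  next
    case GenM
    show ?thesis by (simp add: GenM FC R R' phicoef_Cons Bcount_Cons algebra_simps)
  next
    case GenT
    show ?thesis by (simp add: GenT FC R R' phicoef_Cons Bcount_Cons algebra_simps)
  next
    case GenB
    \<comment> \<open>In the second summand the shift of \<open>j\<close> by -1 from
      \<open>K^-1\<close> is undone by the extra \<open>B\<close> counted in \<open>d\<close>. With
      \<open>n = Bcount d\<close>, the multipliers \<open>h j\<close> and \<open>h (n + 1/2)\<close>
      combine to \<open>h (j + n + 1/2)\<close>, the value of the module with \<open>s = 1/2\<close>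
      at \<open>j + n\<close>.\<close>
    have "csum (g # xs) (\<lambda>c d. phicoef w m d * F c (\<lambda>j. q (j + int (Bcount d)))) =
      csum xs (\<lambda>c d. F c (\<lambda>j. h * of_int j * (phicoef w m d * q (j + int (Bcount d))) +
        h * (of_nat (Bcount d) + 1 / 2) * phicoef w m d * q (j - 1 + int (Suc (Bcount d)))))"
      by (simp only: GenB csum.simps cgen.simps append_Cons append_Nil FC R phicoef_Cons Bcount_Cons
        csum_add[symmetric] F h_def[symmetric])
    also have "\<dots> = csum xs (\<lambda>c d. phicoef w m d * F c (\<lambda>j. ?R' g q (j + int (Bcount d))))"
      by (simp add: GenB R' F algebra_simps)
    finally show ?thesis .
  qed
  then show ?case using Cons[of "?R' g q"] by (simp add: F_def)
qed

text \<open>The module formulas applied to an integer-indexed family of functionals, argument by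
  argument. Each result is a finite linear combination of members, so it commutes with linear maps
  and stays in the span.\<close>

definition family_action ::
  "real \<Rightarrow> real \<Rightarrow> real \<Rightarrow> complex \<Rightarrow> gen \<Rightarrow> (int \<Rightarrow> falg \<Rightarrow> complex) \<Rightarrow> int \<Rightarrow> falg \<Rightarrow> complex" where
  "family_action w m u s g e l = (\<lambda>Y. galilei_action w m u s g (\<lambda>j. e j Y) l)"

lemma family_action_simps:
  "family_action w m u s GenK e l = e (l + 1)"
  "family_action w m u s GenKinv e l = e (l - 1)"
  "family_action w m u s GenB e l = fscale (\<i> * of_real (w * m) * (of_int l + s)) (e l)"
  "family_action w m u s GenM e l = fscale (of_real m) (e l)"
  "family_action w m u s GenT e l = fscale (of_real u) (e l) +
    fscale (of_real (1 / (2 * w\<^sup>2 * m))) (e (l + 1) + e (l - 1) + fscale (- 2) (e l))"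
  by (simp_all add: family_action_def fscale_def fun_eq_iff)

definition functional_linear :: "((falg \<Rightarrow> complex) \<Rightarrow> (falg \<Rightarrow> complex)) \<Rightarrow> bool" where
  "functional_linear L \<longleftrightarrow> (\<forall>f g. L (f + g) = L f + L g) \<and> (\<forall>c f. L (fscale c f) = fscale c (L f))"

lemma family_action_map:
  "functional_linear L \<Longrightarrow> L (family_action w m u s g e l) = family_action w m u s g (\<lambda>j. L (e j)) l"
  by (cases g) (simp_all only: family_action_simps functional_linear_def)

lemma family_action_span:
  assumes "\<And>j. e j \<in> fun_vs.span S"
  shows "family_action w m u s g e l \<in> fun_vs.span S"
  by (cases g) (simp_all only: family_action_simps assms fun_vs.span_add fun_vs.span_scale)

lemma rho_eq_lf:
  "rho w m u X a Y = lf (\<lambda>xs. csum xs (\<lambda>c d. (act (wd c) a \<star> phi_bracket w m u (wd d)) Y)) X"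
  by (simp add: rho_def sweedler_eq_lf)

lemma rho_add_left: "rho w m u (X + Y) a = rho w m u X a + rho w m u Y a"
  and rho_smul: "rho w m u (smul c X) a = fscale c (rho w m u X a)"
  by (simp_all add: rho_eq_lf fun_eq_iff fscale_def)

lemma act_add: "act X (f + g) = act X f + act X g"
  and act_fscale: "act X (fscale c f) = fscale c (act X f)"
  by (simp_all add: act_def fscale_def fun_eq_iff)

lemma functional_linear_rho: "functional_linear (rho w m u X)"
proof -
  have "rho w m u X (f + g) Y = rho w m u X f Y + rho w m u X g Y" for f g Y
    by (simp only: rho_eq_lf act_add conv_add_left plus_fun_apply distrib_right csum_add
      fun_cong[OF lf_plus[symmetric]])
  moreover have "rho w m u X (fscale c f) Y = c * rho w m u X f Y" for c f Y
    by (simp only: rho_eq_lf act_fscale conv_fscale_left)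
      (simp only: fscale_def csum_mult fun_cong[OF fscale_lf[symmetric]])
  ultimately show ?thesis by (simp add: functional_linear_def fun_eq_iff fscale_def)
qed

lemmas rho_add_right = functional_linear_rho[unfolded functional_linear_def, THEN conjunct1, rule_format]
  and rho_fscale = functional_linear_rho[unfolded functional_linear_def, THEN conjunct2, rule_format]

text \<open>The left regular action of a generator on \<open>E_l\<close>, expressed as the module
  action on the index.\<close>

lemma ecoef_mult_wd:
  "lf (ecoef w m u l) (Y * wd [g]) = galilei_action w m u 0 g (\<lambda>j. lf (ecoef w m u j) Y) l"
proof (induction Y rule: falg_induct)
  case (word xs)
  show ?case by (simp only: wd_mult lf_wd ecoef_snoc)
next
  case (smul c X)
  then show ?case
    using linear_galilei_action[of w m u 0] by (simp add: smul_mult_left linear_action_def)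
next
  case (add X Y)
  then show ?case
    using linear_galilei_action[of w m u 0] by (simp add: distrib_right linear_action_def)
qed

section \<open>The modified action as a representation\<close>

context
  fixes w m u :: real
  assumes w: "w \<noteq> 0" and m: "m \<noteq> 0"
begin

lemma act_ebasis_snoc:
  "act (wd (c @ [g])) (ebasis w m u l) = family_action w m u 0 g (\<lambda>j. act (wd c) (ebasis w m u j)) l"
proof
  fix Y
  have "Y * wd (c @ [g]) = Y * wd c * wd [g]" by (simp only: mult.assoc wd_mult)
  then show "act (wd (c @ [g])) (ebasis w m u l) Y =
    family_action w m u 0 g (\<lambda>j. act (wd c) (ebasis w m u j)) l Y"
    by (simp only: act_def ebasis_eq[OF w m] family_action_def ecoef_mult_wd)
qed

text \<open>The word turns \<open>E_l\<close> into a combination of various \<open>E_j\<close>, and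
  right multiplication by \<open>chi^k\<close> then shifts each \<open>j\<close>. The coefficients
  remain those computed at \<open>l\<close>, not at \<open>l + k\<close>.\<close>

lemma act_ebasis_conv:
  "(act (wd c) (ebasis w m u l) \<star> chipow w m u k) Y =
    fold (galilei_action w m u 0) c (\<lambda>j. ebasis w m u (j + k) Y) l"
proof (induction c arbitrary: l rule: rev_induct)
  case Nil
  have "act (wd []) f = f" for f by (simp add: act_def flip: one_eq_wd)
  then show ?case by (simp add: conv_ebasis_chipow[OF w m])
next
  case (snoc g c)
  have "functional_linear (\<lambda>f. f \<star> chipow w m u k)"
    by (simp add: functional_linear_def conv_add_left conv_fscale_left)
  from family_action_map[OF this] have "act (wd (c @ [g])) (ebasis w m u l) \<star> chipow w m u k =
    family_action w m u 0 g (\<lambda>j. act (wd c) (ebasis w m u j) \<star> chipow w m u k) l"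
    unfolding act_ebasis_snoc .
  then show ?case by (simp add: family_action_def snoc)
qed

lemma rho_ebasis:
  "rho w m u X (ebasis w m u l) Y =
    lf (\<lambda>xs. fold (galilei_action w m u (1 / 2)) xs (\<lambda>j. ebasis w m u j Y) l) X"
proof -
  have "csum xs (\<lambda>c d. (act (wd c) (ebasis w m u l) \<star> phi_bracket w m u (wd d)) Y) =
    fold (galilei_action w m u (1 / 2)) xs (\<lambda>j. ebasis w m u j Y) l" for xs
    unfolding phi_bracket_wd conv_fscale_right csum_phicoef[symmetric]
    by (simp only: fscale_def act_ebasis_conv)
  then show ?thesis by (simp only: rho_eq_lf)
qed

lemma rho_one: "rho w m u (wd []) (ebasis w m u l) = ebasis w m u l"
  by (rule ext) (simp only: rho_ebasis lf_wd fold_simps)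

lemma rho_ebasis_snoc:
  "rho w m u (wd (xs @ [g])) (ebasis w m u l) =
    family_action w m u (1 / 2) g (\<lambda>j. rho w m u (wd xs) (ebasis w m u j)) l"
  by (rule ext) (simp add: family_action_def rho_ebasis)

lemma rho_generator: "rho w m u (wd [g]) (ebasis w m u l) = family_action w m u (1 / 2) g (ebasis w m u) l"
  using rho_ebasis_snoc[of "[]" g l] by (simp only: append_Nil rho_one)

text \<open>Appending \<open>g\<close> to \<open>ys\<close> forms a combination of the vectors
  \<open>rho(ys) E_j\<close> with coefficients independent of \<open>ys\<close>; the linear map
  \<open>rho(xs)\<close> passes through it.\<close>

lemma rho_wd_mult:
  "rho w m u (wd (xs @ ys)) (ebasis w m u l) = rho w m u (wd xs) (rho w m u (wd ys) (ebasis w m u l))"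
proof (induction ys arbitrary: l rule: rev_induct)
  case Nil
  then show ?case by (simp only: rho_one append_Nil2)
next
  case (snoc g ys)
  show ?case
    unfolding append_assoc[symmetric] rho_ebasis_snoc family_action_map[OF functional_linear_rho] snoc ..
qed

lemma rho_mult:
  assumes "a \<in> Hspace w m u"
  shows "rho w m u (X * Y) a = rho w m u X (rho w m u Y a)"
  using assms unfolding Hspace_eq[OF w m]
proof (induction rule: span_range_induct)
  case (base l)
  have "rho w m u (wd xs * Y) (ebasis w m u l) = rho w m u (wd xs) (rho w m u Y (ebasis w m u l))" for xs
    by (induction Y rule: falg_induct)
      (simp_all only: wd_mult rho_wd_mult smul_mult_right distrib_left rho_add_left rho_smul
        rho_add_right rho_fscale)
  then show ?case
    by (induction X rule: falg_induct)
      (simp_all only: smul_mult_left distrib_right rho_add_left rho_smul)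
qed (simp_all only: rho_add_right rho_fscale)

lemma rho_closed:
  assumes "a \<in> Hspace w m u"
  shows "rho w m u X a \<in> Hspace w m u"
  using assms unfolding Hspace_eq[OF w m]
proof (induction rule: span_range_induct)
  case (base l)
  have "rho w m u (wd xs) (ebasis w m u l) \<in> fun_vs.span (range (ebasis w m u))" for xs
  proof (induction xs arbitrary: l rule: rev_induct)
    case Nil
    show ?case unfolding rho_one by (rule fun_vs.span_base) (rule rangeI)
  next
    case (snoc g xs)
    show ?case unfolding rho_ebasis_snoc by (rule family_action_span) (rule snoc)
  qed
  then show ?case
    by (induction X rule: falg_induct)
      (simp_all only: rho_add_left rho_smul fun_vs.span_add fun_vs.span_scale)
qed (simp_all only: rho_add_right rho_fscale fun_vs.span_add fun_vs.span_scale)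

lemma rho_ideal:
  assumes "X \<in> galilei_ideal w" "a \<in> Hspace w m u"
  shows "rho w m u X a = 0"
  using assms(2) unfolding Hspace_eq[OF w m]
proof (induction rule: span_range_induct)
  case (base l)
  have "rho w m u X (ebasis w m u l) Y = 0" for Y
    \<comment> \<open>For fixed \<open>Y\<close> and \<open>l\<close>, the value at \<open>Y\<close>
      is a matrix coefficient in \<open>X\<close> of the module with \<open>s = 1/2\<close>, with
      start vector \<open>E_j(Y)\<close> as a function of \<open>j\<close>.\<close>
    using assms(1) matrix_coefficient_Udual[OF galilei_module_galilei_action[OF w m],
      of u "1 / 2" "\<lambda>j. ebasis w m u j Y" l]
    unfolding rho_ebasis Udual_def by blast
  then show ?case by (simp add: fun_eq_iff)
qed (simp_all only: rho_add_right rho_fscale fun_vs.scale_zero_right add_0_left)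

lemma is_representation_rho: "is_representation w (Hspace w m u) (rho w m u)"
  unfolding is_representation_def
proof (intro conjI allI ballI)
  show "fun_vs.subspace (Hspace w m u)"
    unfolding Hspace_eq[OF w m] by (rule fun_vs.subspace_span)
  show "rho w m u 1 a = a" if "a \<in> Hspace w m u" for a
    using that unfolding Hspace_eq[OF w m] one_eq_wd
    by (induction rule: span_range_induct) (simp_all only: rho_one rho_add_right rho_fscale)
qed (simp_all only: rho_closed rho_add_right rho_fscale rho_add_left rho_smul rho_mult rho_ideal)

end

section \<open>The involution and the sesquilinear form\<close>

lemma star_keysum: "star = keysum (\<lambda>x c. Poly_Mapping.single (Word (rev (letters x))) (cnj c))"
  by (simp add: star_def keysum_def fun_eq_iff)

lemma star_add: "star (X + Y) = star X + star Y"
  unfolding star_keysum by (rule keysum_add) (simp_all add: single_add)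

lemma star_single: "star (Poly_Mapping.single x c) = Poly_Mapping.single (Word (rev (letters x))) (cnj c)"
  unfolding star_keysum by (rule keysum_single) simp

lemma star_smul: "star (smul c X) = smul (cnj c) (star X)"
  by (induction X rule: poly_mapping_add_induct)
    (simp_all add: smul_add star_add star_single, simp add: star_keysum)

lemma star_mult: "star (X * Y) = star Y * star X"
proof (induction X rule: falg_induct)
  case (word xs)
  show ?case
    by (induction Y rule: falg_induct)
      (simp_all add: star_single smul_mult_right smul_mult_left star_smul distrib_left distrib_right star_add)
qed (simp_all add: smul_mult_right smul_mult_left star_smul distrib_left distrib_right star_add)

lemma antipode_keysum:
  "antipode w = keysum (\<lambda>x c. smul c (prod_list (map (antipode_gen w) (rev (letters x)))))"
  by (simp add: antipode_def antihom_ext_def keysum_def fun_eq_iff)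

lemma antipode_add: "antipode w (X + Y) = antipode w X + antipode w Y"
  unfolding antipode_keysum by (rule keysum_add) (simp_all add: smul_add_left)

lemma antipode_single:
  "antipode w (Poly_Mapping.single x c) = smul c (prod_list (map (antipode_gen w) (rev (letters x))))"
  unfolding antipode_keysum by (rule keysum_single) simp

lemma antipode_smul: "antipode w (smul c X) = smul c (antipode w X)"
  by (induction X rule: poly_mapping_add_induct)
    (simp_all add: smul_add antipode_add antipode_single, simp add: antipode_keysum)

lemma dual_star_add: "dual_star w (f + g) = dual_star w f + dual_star w g"
  and dual_star_fscale: "dual_star w (fscale c f) = fscale (cnj c) (dual_star w f)"
  by (simp_all add: dual_star_def fscale_def fun_eq_iff)

text \<open>\<open>antipode\<close> and \<open>star\<close> both reverse products, so their
  composite \<tau> preserves the order and induction on the last letter applies. \<open>K\<close>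
  goes to its inverse, which reflects the index. \<open>B\<close> goes to \<open>-B - iwM\<close>,
  with eigenvalue \<open>-h l - h\<close> on \<open>E_l\<close>; the term in \<open>M\<close> causes
  the shift by one.\<close>

lemma dual_star_ecoef:
  "dual_star w (lf (ecoef w m u l)) = lf (ecoef w (- m) (- u) (- (l + 1)))"
proof
  define \<tau> where "\<tau> xs = star (antipode w (wd xs))" for xs
  have \<tau>_snoc: "\<tau> (xs @ [g]) = \<tau> xs * star (antipode_gen w g)" for xs g
    by (simp add: \<tau>_def antipode_single star_mult)
  have "cnj (lf (ecoef w m u l) (\<tau> xs)) = ecoef w (- m) (- u) (- (l + 1)) xs" for xs
  proof (induction xs arbitrary: l rule: rev_induct)
    case Nil
    have "\<tau> [] = wd []" by (simp add: \<tau>_def antipode_single one_eq_wd star_single)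
    then show ?case by simp
  next
    case (snoc g xs)
    define t :: complex where "t = of_real (1 / (2 * w\<^sup>2 * m))"
    define h where "h = \<i> * of_real (w * m)"
    have t': "complex_of_real (1 / (2 * w\<^sup>2 * - m)) = - t" by (simp add: t_def)
    have h': "\<i> * of_real (w * - m) = - h" by (simp add: h_def)
    have cnj: "cnj t = t" "cnj h = - h" by (simp_all add: t_def h_def)
    let ?e = "\<lambda>l. lf (ecoef w m u l) (\<tau> xs)"
    have IH: "cnj (?e l) = ecoef w (- m) (- u) (- (l + 1)) xs" for l by (rule snoc)
    have star_minus: "star (- wd [x]) = smul (- 1) (wd [x])" for x
      by (simp only: smul_minus_one[symmetric] star_smul star_single) simp
    note mult = \<tau>_snoc ecoef_mult_wd galilei_action.simps
    show ?case
    proof (cases g)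
      case GenK
      have "\<tau> (xs @ [g]) = \<tau> xs * wd [GenKinv]"
        by (simp add: GenK \<tau>_snoc generators_eq_wd star_single)
      then show ?thesis using IH[of "l - 1"]
        by (simp only: mult) (simp add: GenK)
    next
      case GenKinv
      have "\<tau> (xs @ [g]) = \<tau> xs * wd [GenK]"
        by (simp add: GenKinv \<tau>_snoc generators_eq_wd star_single)
      then show ?thesis using IH[of "l + 1"]
        by (simp only: mult) (simp add: GenKinv algebra_simps)
    next
      case GenM
      have "\<tau> (xs @ [g]) = smul (- 1) (\<tau> xs * wd [GenM])"
        by (simp only: GenM \<tau>_snoc antipode_gen.simps generators_eq_wd star_minus smul_mult_right)
      then show ?thesis using IH[of l]
        by (simp only: mult lf_smul) (simp add: GenM)
    next
      case GenT
      have "\<tau> (xs @ [g]) = smul (- 1) (\<tau> xs * wd [GenT])"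
        by (simp only: GenT \<tau>_snoc antipode_gen.simps generators_eq_wd star_minus smul_mult_right)
      then have "lf (ecoef w m u l) (\<tau> (xs @ [g])) =
        - 1 * (of_real u * ?e l + t * (?e (l + 1) + ?e (l - 1) - 2 * ?e l))"
        by (simp only: mult lf_smul t_def)
      then show ?thesis
        using IH[of l] IH[of "l + 1"] IH[of "l - 1"]
        by (simp only: GenT ecoef_snoc galilei_action.simps t' complex_cnj_mult complex_cnj_add
          complex_cnj_diff cnj) (simp add: algebra_simps)
    next
      case GenB
      have "star (antipode_gen w GenB) = smul (- 1) (wd [GenB]) + smul (- (\<i> * of_real w)) (wd [GenM])"
        by (simp only: antipode_gen.simps generators_eq_wd star_add star_minus star_smul)
          (simp add: star_single single_uminus)
      then have "\<tau> (xs @ [g]) = smul (- 1) (\<tau> xs * wd [GenB]) + smul (- (\<i> * of_real w)) (\<tau> xs * wd [GenM])"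
        by (simp only: GenB \<tau>_snoc distrib_left smul_mult_right)
      then have "lf (ecoef w m u l) (\<tau> (xs @ [g])) = - h * (of_int l + 1) * ?e l"
        by (simp only: mult lf_smul lf_add) (simp add: h_def algebra_simps)
      then show ?thesis
        by (simp only: GenB ecoef_snoc galilei_action.simps h' complex_cnj_mult cnj IH[of l])
          (simp add: cnj algebra_simps)
    qed
  qed
  then show "dual_star w (lf (ecoef w m u l)) X = lf (ecoef w (- m) (- u) (- (l + 1))) X" for X
    by (induction X rule: falg_induct)
      (simp_all only: dual_star_def \<tau>_def lf_wd antipode_smul star_smul lf_smul complex_cnj_mult
        complex_cnj_cnj antipode_add star_add lf_add complex_cnj_add)
qed

context
  fixes w m u :: real
  assumes w: "w \<noteq> 0" and m: "m \<noteq> 0"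
begin

lemma dual_star_conv_ebasis:
  "dual_star w (ebasis w m u l) \<star> ebasis w m u n = chipow w m u (l + n + 1)"
  by (simp add: ebasis_eq[OF w m] dual_star_ecoef conv_ecoef_neg_ecoef chipow_eq[OF w m] algebra_simps)

text \<open>\<open>nu\<close> is read off from \<open>representation\<close>, whose linearity laws
  apply inside the span of the powers of \<open>chi\<close>.\<close>

lemma dual_star_conv_span:
  assumes "a \<in> Hspace w m u" "b \<in> Hspace w m u"
  shows "dual_star w a \<star> b \<in> fun_vs.span (range (chipow w m u))"
  using assms(1) unfolding Hspace_eq[OF w m]
proof (induction rule: span_range_induct)
  case (base l)
  have chi: "chipow w m u k \<in> fun_vs.span (range (chipow w m u))" for k
    by (rule fun_vs.span_base) (rule rangeI)
  show ?case using assms(2) unfolding Hspace_eq[OF w m]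
    by (induction rule: span_range_induct)
      (simp_all only: dual_star_conv_ebasis chi conv_add_right conv_fscale_right
        fun_vs.span_add fun_vs.span_scale)
qed (simp_all only: dual_star_add dual_star_fscale conv_add_left conv_fscale_left
    fun_vs.span_add fun_vs.span_scale)

lemma nu_chipow: "nu w m u (chipow w m u l) = (if l = 0 then 1 else 0)"
  using inj_chipow[OF w m]
  by (simp add: nu_def fun_vs.representation_basis[OF independent_chipow[OF w m]] inj_eq)

lemma nu_add:
  assumes "f \<in> fun_vs.span (range (chipow w m u))" "g \<in> fun_vs.span (range (chipow w m u))"
  shows "nu w m u (f + g) = nu w m u f + nu w m u g"
  unfolding nu_def
  using fun_cong[OF fun_vs.representation_add[OF independent_chipow[OF w m] assms(2,1)]] by simp

lemma nu_fscale:
  assumes "f \<in> fun_vs.span (range (chipow w m u))"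
  shows "nu w m u (fscale c f) = c * nu w m u f"
  unfolding nu_def
  using fun_cong[OF fun_vs.representation_scale[OF independent_chipow[OF w m] assms]] by simp

lemma form_ebasis: "form w m u (ebasis w m u l) (ebasis w m u n) = (if l + n + 1 = 0 then 1 else 0)"
  unfolding form_def dual_star_conv_ebasis nu_chipow ..

lemma form_additive:
  assumes "a \<in> Hspace w m u" "b \<in> Hspace w m u" "c \<in> Hspace w m u"
  shows form_add_left: "form w m u (a + b) c = form w m u a c + form w m u b c"
    and form_add_right: "form w m u c (a + b) = form w m u c a + form w m u c b"
  unfolding form_def dual_star_add conv_add_left conv_add_right
  by (intro nu_add dual_star_conv_span assms)+

lemma form_homogeneous:
  assumes "a \<in> Hspace w m u" "b \<in> Hspace w m u"
  shows form_fscale_left: "form w m u (fscale k a) b = cnj k * form w m u a b"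
    and form_fscale_right: "form w m u a (fscale k b) = k * form w m u a b"
  unfolding form_def dual_star_fscale conv_fscale_left conv_fscale_right
  by (intro nu_fscale dual_star_conv_span assms)+

lemmas form_linear = form_additive form_homogeneous

lemma Hspace_closed:
  shows ebasis_in_Hspace: "ebasis w m u l \<in> Hspace w m u"
    and Hspace_add: "a \<in> Hspace w m u \<Longrightarrow> b \<in> Hspace w m u \<Longrightarrow> a + b \<in> Hspace w m u"
    and Hspace_fscale: "a \<in> Hspace w m u \<Longrightarrow> fscale k a \<in> Hspace w m u"
  unfolding Hspace_eq[OF w m]
  by (simp_all only: fun_vs.span_base rangeI fun_vs.span_add fun_vs.span_scale)

lemma Hspace_induct [consumes 1, case_names base add scale]:
  assumes "a \<in> Hspace w m u" "\<And>l. P (ebasis w m u l)"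
    "\<And>a b. a \<in> Hspace w m u \<Longrightarrow> b \<in> Hspace w m u \<Longrightarrow> P a \<Longrightarrow> P b \<Longrightarrow> P (a + b)"
    "\<And>k a. a \<in> Hspace w m u \<Longrightarrow> P a \<Longrightarrow> P (fscale k a)"
  shows "P a"
proof -
  have "a \<in> Hspace w m u \<and> P a"
    using assms(1) unfolding Hspace_eq[OF w m]
    by (induction rule: span_range_induct)
      (use assms(2-4) Hspace_closed in \<open>auto simp only: Hspace_eq[OF w m, symmetric]\<close>)
  then show ?thesis ..
qed

text \<open>The form depends on \<open>l + n\<close> only, so shifting either argument gives the
  same value; this settles \<open>K\<close>, its inverse and \<open>T\<close>, and \<open>M\<close>
  is a real scalar.\<close>

lemma form_generator_ebasis:
  "form w m u (ebasis w m u l) (rho w m u (wd [g]) (ebasis w m u n)) =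
    form w m u (rho w m u (wd [g]) (ebasis w m u l)) (ebasis w m u n)"
proof -
  note closed = Hspace_closed
  show ?thesis
  proof (cases g)
    case GenB
    show ?thesis
      unfolding GenB rho_generator[OF w m] family_action_simps
        form_fscale_left[OF closed(1) closed(1)] form_fscale_right[OF closed(1) closed(1)]
        form_ebasis
    proof (cases "l + n + 1 = 0")
      case True
      \<comment> \<open>On the support of the form \<open>n + 1/2 = -(l + 1/2)\<close>, and this
        sign is matched by conjugating the imaginary factor \<open>iwm\<close>.\<close>
      then have n: "n = - l - 1" by simp
      show "\<i> * of_real (w * m) * (of_int n + 1 / 2) * (if l + n + 1 = 0 then 1 else 0) =
        cnj (\<i> * of_real (w * m) * (of_int l + 1 / 2)) * (if l + n + 1 = 0 then 1 else 0)"
        unfolding n by (simp add: algebra_simps)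
    qed simp
  qed (simp_all only: rho_generator[OF w m] family_action_simps form_linear closed form_ebasis,
      simp_all add: algebra_simps)
qed

lemma form_generator:
  assumes "a \<in> Hspace w m u" "b \<in> Hspace w m u"
  shows "form w m u a (rho w m u (wd [g]) b) = form w m u (rho w m u (wd [g]) a) b"
  using assms(1)
proof (induction rule: Hspace_induct)
  case (base l)
  show ?case using assms(2)
    by (induction rule: Hspace_induct)
      (simp_all only: form_generator_ebasis rho_add_right rho_fscale form_linear rho_closed[OF w m] Hspace_closed)
qed (use assms(2) in \<open>simp_all only: rho_add_right rho_fscale form_linear rho_closed[OF w m] Hspace_closed\<close>)

text \<open>Moving the generators across one at a time reverses the word, as \<open>star\<close>
  does; conjugated scalars match antilinearity in the first argument.\<close>

lemma form_unitary:
  assumes "a \<in> Hspace w m u" "b \<in> Hspace w m u"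
  shows "form w m u a (rho w m u X b) = form w m u (rho w m u (star X) a) b"
proof (induction X rule: falg_induct)
  case (word xs)
  have "form w m u a (rho w m u (wd xs) b) = form w m u (rho w m u (wd (rev xs)) a) b"
    using assms(1)
  proof (induction xs arbitrary: a)
    case Nil
    have one: "rho w m u (wd []) c = c" if "c \<in> Hspace w m u" for c
      using is_representation_rho[OF w m] that by (simp only: is_representation_def one_eq_wd)
    show ?case by (simp only: one Nil assms(2) rev.simps)
  next
    case (Cons g xs)
    have "form w m u a (rho w m u (wd (g # xs)) b) = form w m u a (rho w m u (wd [g]) (rho w m u (wd xs) b))"
      using rho_mult[OF w m assms(2), of "wd [g]" "wd xs"] by (simp only: wd_mult append_Cons append_Nil)
    also have "\<dots> = form w m u (rho w m u (wd [g]) a) (rho w m u (wd xs) b)"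
      by (rule form_generator) (simp_all only: Cons rho_closed[OF w m] assms(2))
    also have "\<dots> = form w m u (rho w m u (wd (rev xs)) (rho w m u (wd [g]) a)) b"
      by (rule Cons.IH) (simp only: Cons.prems rho_closed[OF w m])
    also have "\<dots> = form w m u (rho w m u (wd (rev (g # xs))) a) b"
      using rho_mult[OF w m Cons.prems, of "wd (rev xs)" "wd [g]"] by (simp only: wd_mult rev.simps)
    finally show ?case .
  qed
  then show ?case by (simp add: star_single)
qed (simp_all only: rho_add_left rho_smul star_add star_smul form_linear assms rho_closed[OF w m]
    complex_cnj_cnj)

end

theorem proposition5p2:
  fixes w m u :: real
  assumes "w \<noteq> 0" and "m \<noteq> 0"
  shows
    "(inj (ebasis w m u) \<and>
      fun_vs.independent (range (ebasis w m u)) \<and>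
      fun_vs.span (range (ebasis w m u)) = Hspace w m u) \<and>
     is_representation w (Hspace w m u) (rho w m u) \<and>
     (\<forall>l. rho w m u Kq (ebasis w m u l) = ebasis w m u (l + 1)) \<and>
     (\<forall>l. rho w m u Kinvq (ebasis w m u l) = ebasis w m u (l - 1)) \<and>
     (\<forall>l. rho w m u Bq (ebasis w m u l) =
        fscale (\<i> * of_real (w * m * (of_int l + 1 / 2))) (ebasis w m u l)) \<and>
     (\<forall>l. rho w m u Tq (ebasis w m u l) =
        ebasis w m u l \<star>
          (fscale (of_real (- (1 / (2 * w\<^sup>2 * m))))
             (fscale 2 counit - chipow w m u 1 - chipow w m u (- 1)) +
           fscale (of_real u) counit)) \<and>
     sesquilinear_on (Hspace w m u) (form w m u) \<and>
     (\<forall>l n. form w m u (ebasis w m u l) (ebasis w m u n) = (if l + n + 1 = 0 then 1 else 0)) \<and>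
     (\<forall>X. \<forall>a\<in>Hspace w m u. \<forall>b\<in>Hspace w m u.
        form w m u a (rho w m u X b) = form w m u (rho w m u (star X) a) b)"
proof (intro conjI allI ballI)
  note generator = rho_generator[OF assms] family_action_simps
  show "rho w m u Kq (ebasis w m u l) = ebasis w m u (l + 1)"
    and "rho w m u Kinvq (ebasis w m u l) = ebasis w m u (l - 1)" for l
    by (simp_all only: generators_eq_wd generator)
  have "complex_of_real (w * m * (real_of_int l + 1 / 2)) = of_real (w * m) * (of_int l + 1 / 2)" for l
    by simp
  then show "rho w m u Bq (ebasis w m u l) = fscale (\<i> * of_real (w * m * (of_int l + 1 / 2))) (ebasis w m u l)" for l
    by (simp only: generators_eq_wd generator mult.assoc)
  show "rho w m u Tq (ebasis w m u l) = ebasis w m u l \<star>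
      (fscale (of_real (- (1 / (2 * w\<^sup>2 * m)))) (fscale 2 counit - chipow w m u 1 - chipow w m u (- 1)) +
       fscale (of_real u) counit)" for l
  proof -
    define t :: complex where "t = of_real (1 / (2 * w\<^sup>2 * m))"
    have t': "complex_of_real (- (1 / (2 * w\<^sup>2 * m))) = - t" by (simp add: t_def)
    have counit: "ebasis w m u l \<star> counit = ebasis w m u l"
      by (simp only: ebasis_eq[OF assms] conv_counit_right)
    have "ebasis w m u l \<star> (fscale (- t) (fscale 2 counit - chipow w m u 1 - chipow w m u (- 1)) +
        fscale (of_real u) counit) =
      fscale (- t) (fscale 2 (ebasis w m u l) - ebasis w m u (l + 1) - ebasis w m u (l - 1)) +
        fscale (of_real u) (ebasis w m u l)"
      by (simp only: conv_add_right conv_diff_right conv_fscale_right counit conv_ebasis_chipow[OF assms])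
        simp
    then show ?thesis
      unfolding generators_eq_wd generator t' t_def[symmetric]
      by (simp add: fscale_def fun_eq_iff algebra_simps)
  qed
  show "fun_vs.span (range (ebasis w m u)) = Hspace w m u" by (rule Hspace_eq[OF assms, symmetric])
  show "sesquilinear_on (Hspace w m u) (form w m u)"
    unfolding sesquilinear_on_def by (intro conjI ballI allI form_linear[OF assms])
qed (simp_all only: inj_ebasis[OF assms] independent_ebasis[OF assms] is_representation_rho[OF assms]
    form_ebasis[OF assms] form_unitary[OF assms] not_False_eq_True)

end
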